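(* Define the integral operator $Q_z$ by $$[Q_zf](x_1,\dots,x_L)=\frac1{\phi_\delta(z)\,a_\delta(x_1,\dots,x_L)}\int_1^z\frac{dw}{w}\int_{\mathbf D}d\mathbf Y\;a_\delta(y_1,\dots,y_L)\,f(y_1,\dots,y_L),$$ where $$\int_{\mathbf D}d\mathbf Y=\iint_{\mathcal D_1}dY_1\cdots\iint_{\mathcal D_{L-1}}dY_{L-1}\left[\int_{t_1\cdots t_{L-1}x_L}^{\infty}dy_L\;\delta\!\left(y_L-w\,x_L\prod_{l=1}^{L-1}\frac{x_lt_l^2}{y_l}\right)+\int_0^{t_1\cdots t_{L-1}x_1}dy_L\;\delta\!\left(y_L-\frac{x_L}{w}\prod_{l=1}^{L-1}\frac{x_lt_l^2}{y_l}\right)\right]$$ and $\delta(\cdot)$ with a parenthesised argument is the Dirac delta function. Then $Q_z$ satisfies, for the symplectic characters $\chi_\lambda$, $$[Q_z\chi_\lambda](x_1,\dots,x_L)=q_\lambda(z)\,\chi_\lambda(x_1,\dots,x_L).$$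
   Context: Here $\lambda=(\lambda_1\ge\dots\ge\lambda_L)$ is a partition, and (as a subscript) $\delta=(L,L-1,\dots,1)$, $\mu=\lambda+\delta$. $a_\mu(x_1,\dots,x_L)=\det[x_i^{\mu_j}-x_i^{-\mu_j}]_{i,j=1}^L$; $a^{(1)}_\mu=\det[\mu_j^{2(L-i)+1}]_{i,j=1}^L$; $a^{(2)}_\mu(z)$ is the determinant of the $L\times L$ matrix with first row $z^{\mu_j}-z^{-\mu_j}$ and $(i,j)$ entry $\mu_j^{2(L-i)+1}$ for $i\ge2$; $\phi_\mu(z)=a^{(2)}_\mu(z)/a^{(1)}_\mu$. The symplectic character is $\chi_\lambda=a_{\lambda+\delta}/a_\delta$, and $q_\lambda(z)=\chi_\lambda(z,1,\dots,1)/\chi_\lambda(1,\dots,1)$. Integration: the integration variables are $t_1,\dots,t_{L-1}$, $y_1,\dots,y_L$ and $w$, and they interlace the $x$'s as $x_i\le y_i/t_i\le x_{i+1}$ for $i=1,\dots,L-1$. For any Laurent series $h(t)=\sum_{m\in\mathbb Z}c_mt^m$ with no constant term ($c_0=0$), $$\int_P\frac{dt}{t}h(t):=\int_0^1\frac{dt}{t}\sum_{m>0}c_mt^m-\int_1^\infty\frac{dt}{t}\sum_{m<0}c_mt^m=\sum_{m\in\mathbb Z}\frac{c_m}{m},$$ and for $1\le i\le L-1$, $\displaystyle\iint_{\mathcal D_i}dY_i=\int_P\frac{dt_i}{t_i}\int_{t_ix_i}^{t_ix_{i+1}}\frac{dy_i}{y_i}$. The two domains for $y_L$ are $x_L<y_L/(t_1\cdots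 t_{L-1})<\infty$ and $0<y_L/(t_1\cdots t_{L-1})<x_1$.
   Formalization: The w-integrand is taken, for all w, to be the Laurent series in w representing the D-integral for w > x_L/x_1; with the y_L-ranges as sharp cut-offs for smaller w the identity fails for L ≥ 3 (z near 1). Here 0 < x_1 < … < x_L and z > 0, z ≠ 1 are real. *)

theory Defs
  imports "HOL-Probability.Probability" "Jordan_Normal_Form.Determinant"
begin

(* Tuples (x_1, ..., x_L) are functions on nat of which only the values at 1, ..., L matter.
   Matrices are indexed from 0, hence the successors below. *)

definition delta :: "nat \<Rightarrow> nat \<Rightarrow> nat" where
  "delta L j = L + 1 - j"

definition alternant :: "nat \<Rightarrow> (nat \<Rightarrow> nat) \<Rightarrow> (nat \<Rightarrow> real) \<Rightarrow> real" where
  "alternant L mu x = Determinant.det (Matrix.mat L L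
     (\<lambda>(i, j). x (Suc i) powi int (mu (Suc j)) - x (Suc i) powi (- int (mu (Suc j)))))"

definition alternant1 :: "nat \<Rightarrow> (nat \<Rightarrow> nat) \<Rightarrow> real" where
  "alternant1 L mu = Determinant.det (Matrix.mat L L
     (\<lambda>(i, j). real (mu (Suc j)) ^ (2 * (L - Suc i) + 1)))"

definition alternant2 :: "nat \<Rightarrow> (nat \<Rightarrow> nat) \<Rightarrow> real \<Rightarrow> real" where
  "alternant2 L mu z = Determinant.det (Matrix.mat L L
     (\<lambda>(i, j). if i = 0 then z powi int (mu (Suc j)) - z powi (- int (mu (Suc j)))
               else real (mu (Suc j)) ^ (2 * (L - Suc i) + 1)))"

definition phi :: "nat \<Rightarrow> (nat \<Rightarrow> nat) \<Rightarrow> real \<Rightarrow> real" where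
  "phi L mu z = alternant2 L mu z / alternant1 L mu"

(* The quotient of alternants is a Laurent polynomial in x; the limit gives its value also where
   the denominator vanishes, for instance at (z, 1, ..., 1). *)
definition symp_char :: "nat \<Rightarrow> (nat \<Rightarrow> nat) \<Rightarrow> (nat \<Rightarrow> real) \<Rightarrow> real" where
  "symp_char L lam x =
     Lim (at x within {y. alternant L (delta L) y \<noteq> 0})
       (\<lambda>y. alternant L (\<lambda>j. lam j + delta L j) y / alternant L (delta L) y)"

definition q_eigenvalue :: "nat \<Rightarrow> (nat \<Rightarrow> nat) \<Rightarrow> real \<Rightarrow> real" where
  "q_eigenvalue L lam z =
     symp_char L lam (\<lambda>i. if i = 1 then z else 1) / symp_char L lam (\<lambda>i. 1)"

(* The coefficients are unique if S contains a nonempty open subset of the positive reals. *)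
definition laurent_coeff :: "real set \<Rightarrow> (real \<Rightarrow> real) \<Rightarrow> int \<Rightarrow> real" where
  "laurent_coeff S h = (THE c. \<forall>t\<in>S. ((\<lambda>m. c m * t powi m) has_sum h t) UNIV)"

definition laurent_extension :: "real set \<Rightarrow> (real \<Rightarrow> real) \<Rightarrow> real \<Rightarrow> real" where
  "laurent_extension S h t = (\<Sum>\<^sub>\<infinity>m. laurent_coeff S h m * t powi m)"

definition P_integral :: "(real \<Rightarrow> real) \<Rightarrow> real" where
  "P_integral h =
     (let c = laurent_coeff {0<..} h in
      if c 0 = 0 then
        (LBINT t=0..1. (\<Sum>\<^sub>\<infinity>m\<in>{0<..}. c m * t powi m) / t) -
        (LBINT t=1..\<infinity>. (\<Sum>\<^sub>\<infinity>m\<in>{..<0}. c m * t powi m) / t)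
      else undefined)"

(* The double integral over dY_i; G depends on the tuples t and y. *)
definition dY_integral ::
    "(nat \<Rightarrow> real) \<Rightarrow> nat \<Rightarrow> ((nat \<Rightarrow> real) \<Rightarrow> (nat \<Rightarrow> real) \<Rightarrow> real)
     \<Rightarrow> (nat \<Rightarrow> real) \<Rightarrow> (nat \<Rightarrow> real) \<Rightarrow> real" where
  "dY_integral x i G t y =
     P_integral (\<lambda>s. LBINT u = s * x i..s * x (Suc i). G (t(i := s)) (y(i := u)) / u)"

(* The bracket of integrals over y_L. Integration of a Dirac delta centred at s is integration
   with respect to the unit point mass at s, that is, the measure return borel s. *)
definition yL_integral ::
    "nat \<Rightarrow> (nat \<Rightarrow> real) \<Rightarrow> real \<Rightarrow> ((nat \<Rightarrow> real) \<Rightarrow> real)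
     \<Rightarrow> (nat \<Rightarrow> real) \<Rightarrow> (nat \<Rightarrow> real) \<Rightarrow> real" where
  "yL_integral L x w F t y =
     (LINT v:{(\<Prod>l=1..<L. t l) * x L<..}
        |return borel (w * x L * (\<Prod>l=1..<L. x l * (t l)\<^sup>2 / y l)). F (y(L := v))) +
     (LINT v:{0<..<(\<Prod>l=1..<L. t l) * x 1}
        |return borel (x L / w * (\<Prod>l=1..<L. x l * (t l)\<^sup>2 / y l)). F (y(L := v)))"

(* The fold makes i = 1 the outermost integral and yL_integral the innermost one. The initial
   tuples are irrelevant, since every entry that is used gets overwritten. *)
definition D_integral :: "nat \<Rightarrow> (nat \<Rightarrow> real) \<Rightarrow> real \<Rightarrow> ((nat \<Rightarrow> real) \<Rightarrow> real) \<Rightarrow> real" where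
  "D_integral L x w F =
     foldr (dY_integral x) [1..<L] (yL_integral L x w F) (\<lambda>_. 1) (\<lambda>_. 1)"

(* For x_1 \<le> ... \<le> x_L and w > x_L / x_1 both point masses lie in their ranges of y_L for all
   interlacing y_1, ..., y_(L-1), and D_integral is given by a Laurent series in w. For smaller w
   the ranges would cut off part of the domain, which for L \<ge> 3 destroys the eigenvalue property;
   the integrand of the w-integral is therefore this Laurent series for all w. *)
definition Q_operator ::
    "nat \<Rightarrow> real \<Rightarrow> ((nat \<Rightarrow> real) \<Rightarrow> real) \<Rightarrow> (nat \<Rightarrow> real) \<Rightarrow> real" where
  "Q_operator L z f x =
     1 / (phi L (delta L) z * alternant L (delta L) x) *
     (LBINT w=1..z.
        laurent_extension {x L / x 1<..}
          (\<lambda>w. D_integral L x w (\<lambda>y. alternant L (delta L) y * f y)) w / w)"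

end

theory Submission
  imports Defs "HOL-Complex_Analysis.Complex_Analysis"
begin

text \<open>
  Write \<open>\<mu> = \<lambda> + \<delta>\<close>. Since \<open>a\<^sub>\<delta> \<chi>\<^sub>\<lambda> = a\<^sub>\<mu>\<close> is a signed sum of monomials, the iterated
  integral can be evaluated monomial by monomial: if \<open>y\<^sub>L\<close> carries the exponent \<open>n\<close> and \<open>y\<^sub>i\<close> the
  exponent \<open>m\<close>, the double integral over \<open>dY\<^sub>i\<close> gives
  \<open>(x\<^sub>i\<^sup>n x\<^bsub>i+1\<^esub>\<^bsup>m-n\<^esup> - x\<^sub>i\<^sup>m) / (m\<^sup>2 - n\<^sup>2)\<close>, and the integral over \<open>w\<close> gives \<open>(z\<^sup>n - z\<^bsup>-n\<^esup>) / n\<close>.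
  For fixed \<open>n = \<plusminus>\<mu>\<^sub>j\<close> the numerators sum to the determinant of the differences of successive rows, each scaled
  by \<open>x\<^sub>i\<^bsup>-n\<^esup>\<close>, of the matrix of \<open>a\<^sub>\<mu>(x)\<close> with column \<open>j\<close> replaced by \<open>x\<^sub>i\<^sup>n\<close>; adding both signs of \<open>n\<close>
  gives \<open>\<plusminus>a\<^sub>\<mu>(x)\<close>. The remaining factors depend only on \<open>j\<close>, and by Lagrange interpolation in the nodes
  \<open>\<mu>\<^sub>j\<^sup>2\<close> they sum to \<open>\<phi>\<^sub>\<mu>(z)\<close>.

  In the variables \<open>v = y + 1/y - 2\<close> the character is a determinant of divided differences of polynomials,
  hence continuous, and its values at \<open>(1, ..., 1)\<close> and \<open>(z, 1, ..., 1)\<close> give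
  \<open>q\<^sub>\<lambda>(z) = \<phi>\<^sub>\<mu>(z) / \<phi>\<^sub>\<delta>(z)\<close>.
\<close>

section \<open>Uniqueness of Laurent coefficients\<close>

text \<open>The nonnegative powers form an entire function A(w), the negative ones a power series B
  in 1/w with B(0) = 0. Analytic continuation from the real ray gives A(w) = - B(1/w) outside the
  disc of radius \<open>R\<close>, so A tends to 0 at infinity, vanishes by Liouville's theorem, and
  then so does B.\<close>

lemma two_sided_series_zero:
  fixes e :: "int \<Rightarrow> real" and R :: real
  assumes R: "R > 0"
    and sum0: "\<And>t. t > R \<Longrightarrow> ((\<lambda>m. e m * t powi m) has_sum 0) UNIV"
  shows "e m = 0"
proof -
  define A :: "complex fps" where "A = Abs_fps (\<lambda>n. of_real (e (int n)))"
  define B :: "complex fps" where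
    "B = Abs_fps (\<lambda>n. if n = 0 then 0 else of_real (e (- int n)))"
  have int_im: "range int = {0..}"
  proof (intro equalityI subsetI)
    fix k :: int assume "k \<in> {0..}"
    thus "k \<in> range int" by (intro image_eqI[of _ _ "nat k"]) auto
  qed auto
  have A_series: "(\<lambda>n. fps_nth A n * of_real t ^ n) sums of_real (infsum (\<lambda>m. e m * t powi m) {0..})"
    if t: "t > R" for t
  proof -
    have "(\<lambda>m. e m * t powi m) summable_on {0..}"
      using sum0[OF t] by (meson has_sum_imp_summable subset_UNIV summable_on_subset_banach)
    hence "((\<lambda>m. e m * t powi m) has_sum infsum (\<lambda>m. e m * t powi m) {0..}) (int ` UNIV)"
      by (simp add: int_im)
    hence "((\<lambda>n. e (int n) * t ^ n) has_sum infsum (\<lambda>m. e m * t powi m) {0..}) UNIV"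
      by (subst (asm) has_sum_reindex) (auto simp: o_def)
    hence "(\<lambda>n. e (int n) * t ^ n) sums infsum (\<lambda>m. e m * t powi m) {0..}"
      by (rule has_sum_imp_sums)
    hence "(\<lambda>n. of_real (e (int n) * t ^ n)) sums
        (of_real (infsum (\<lambda>m. e m * t powi m) {0..}) :: complex)"
      by (simp only: sums_of_real_iff)
    thus ?thesis by (simp add: A_def)
  qed
  have B_series: "(\<lambda>n. fps_nth B n * of_real (inverse t) ^ n) sums
      of_real (infsum (\<lambda>m. e m * t powi m) {..<0})" if t: "t > R" for t
  proof -
    have im: "(\<lambda>n. - int n) ` {1..} = {..<0}"
    proof (intro equalityI subsetI)
      fix k :: int assume "k \<in> {..<0}"
      thus "k \<in> (\<lambda>n. - int n) ` {1..}" by (intro image_eqI[of _ _ "nat (-k)"]) auto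
    qed auto
    have "(\<lambda>m. e m * t powi m) summable_on {..<0}"
      using sum0[OF t] by (meson has_sum_imp_summable subset_UNIV summable_on_subset_banach)
    hence "((\<lambda>m. e m * t powi m) has_sum infsum (\<lambda>m. e m * t powi m) {..<0}) ((\<lambda>n. - int n) ` {1..})"
      unfolding im by (rule has_sum_infsum)
    hence "((\<lambda>n. e (- int n) * t powi (- int n)) has_sum infsum (\<lambda>m. e m * t powi m) {..<0}) {1..}"
      by (subst (asm) has_sum_reindex) (auto simp: o_def inj_on_def)
    also have "?this \<longleftrightarrow> ((\<lambda>n. (if n = 0 then 0 else e (- int n)) * inverse t ^ n) has_sum
       infsum (\<lambda>m. e m * t powi m) {..<0}) UNIV"
      by (rule has_sum_cong_neutral) (auto simp: power_int_minus power_inverse)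
    finally have "(\<lambda>n. (if n = 0 then 0 else e (- int n)) * inverse t ^ n) sums
       infsum (\<lambda>m. e m * t powi m) {..<0}"
      by (rule has_sum_imp_sums)
    hence "(\<lambda>n. of_real ((if n = 0 then 0 else e (- int n)) * inverse t ^ n)) sums
        (of_real (infsum (\<lambda>m. e m * t powi m) {..<0}) :: complex)"
      by (simp only: sums_of_real_iff)
    moreover have "(\<lambda>n. of_real ((if n = 0 then 0 else e (- int n)) * inverse t ^ n)) =
        (\<lambda>n. fps_nth B n * (of_real (inverse t) :: complex) ^ n)"
      by (auto simp: B_def fun_eq_iff)
    ultimately show ?thesis by simp
  qed
  \<comment> \<open>Convergence at arbitrarily large real \<open>t\<close> makes the radius
    infinite.\<close>
  have A_rad: "fps_conv_radius A = \<infinity>"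
  proof -
    have "ereal r \<le> fps_conv_radius A" for r
    proof -
      define t where "t = max (R + 1) r"
      have "t > R" "t \<ge> r" "t > 0" using R by (auto simp: t_def)
      have "ereal (norm (of_real t :: complex)) \<le> fps_conv_radius A"
        unfolding fps_conv_radius_def
        by (rule conv_radius_geI) (use A_series[OF \<open>t > R\<close>] in \<open>auto simp: sums_iff\<close>)
      thus ?thesis using \<open>t \<ge> r\<close> \<open>t > 0\<close> by (simp add: order_trans[of "ereal r" "ereal t"])
    qed
    thus ?thesis by (simp add: ereal_top)
  qed
  have B_rad: "fps_conv_radius B \<ge> 1 / R"
  proof (rule dense_le)
    fix y :: ereal assume y: "y < ereal (1 / R)"
    show "y \<le> fps_conv_radius B"
    proof (cases "y > 0")
      case True
      then obtain r where r: "y = ereal r" "0 < r" "r < 1 / R" using y by (cases y) auto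
      have t: "1 / r > R" using r R by (simp add: field_simps)
      have "ereal (norm (of_real (inverse (1/r)) :: complex)) \<le> fps_conv_radius B"
        unfolding fps_conv_radius_def
        by (rule conv_radius_geI) (use B_series[OF t] in \<open>auto simp: sums_iff\<close>)
      thus ?thesis using r by simp
    next
      case False
      thus ?thesis
        by (metis conv_radius_nonneg fps_conv_radius_def linorder_not_le order.trans)
    qed
  qed
  have B_pos: "fps_conv_radius B > 0"
  proof -
    have "0 < ereal (1 / R)" using R by simp
    thus ?thesis using B_rad by (rule less_le_trans)
  qed
  have AB: "eval_fps A (of_real t) + eval_fps B (inverse (of_real t)) = 0" if t: "t > R" for t
  proof -
    have s: "(\<lambda>m. e m * t powi m) summable_on UNIV" using sum0[OF t] has_sum_imp_summable by blast
    have "infsum (\<lambda>m. e m * t powi m) ({0..} \<union> {..<0}) =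
       infsum (\<lambda>m. e m * t powi m) {0..} + infsum (\<lambda>m. e m * t powi m) {..<0}"
      by (rule infsum_Un_disjoint) (use s in \<open>auto intro: summable_on_subset_banach\<close>)
    moreover have "{0..} \<union> {..<0::int} = UNIV" by auto
    ultimately have "infsum (\<lambda>m. e m * t powi m) {0..} + infsum (\<lambda>m. e m * t powi m) {..<0} = 0"
      using infsumI[OF sum0[OF t]] by simp
    hence "(of_real (infsum (\<lambda>m. e m * t powi m) {0..}) :: complex) + of_real (infsum (\<lambda>m. e m * t powi m) {..<0}) = 0"
      by (metis of_real_0 of_real_add)
    moreover have "eval_fps A (of_real t) = of_real (infsum (\<lambda>m. e m * t powi m) {0..})"
      using A_series[OF t] by (simp add: eval_fps_def sums_iff)
    moreover have "eval_fps B (inverse (of_real t)) = of_real (infsum (\<lambda>m. e m * t powi m) {..<0})"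
      using B_series[OF t] by (simp add: eval_fps_def sums_iff)
    ultimately show ?thesis by simp
  qed
  define S where "S = - cball (0::complex) R"
  have inv_in: "inverse w \<in> eball 0 (fps_conv_radius B)" if "w \<in> S" for w
  proof -
    have w: "norm w > R" using that by (simp add: S_def)
    have "norm (inverse w) < inverse R"
      unfolding norm_inverse using w R by (rule less_imp_inverse_less)
    hence "norm (inverse w) < 1 / R" by (simp only: inverse_eq_divide)
    hence "ereal (norm (inverse w)) < ereal (1 / R)" by simp
    also note B_rad
    finally show ?thesis by (simp add: in_eball_iff)
  qed
  have nz: "w \<noteq> 0" if "w \<in> S" for w using that R by (auto simp: S_def)
  have AB': "eval_fps A w + eval_fps B (inverse w) = 0" if w: "w \<in> S" for w
  proof (rule analytic_continuation[of "\<lambda>w. eval_fps A w + eval_fps B (inverse w)" S "of_real ` {R<..}" "of_real (R + 1)"])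
    show "(\<lambda>w. eval_fps A w + eval_fps B (inverse w)) holomorphic_on S"
    proof (intro holomorphic_intros)
      show "S \<subseteq> eball 0 (fps_conv_radius A)" by (simp add: A_rad)
      have "(eval_fps B \<circ> inverse) holomorphic_on S"
        by (rule holomorphic_on_compose_gen[of _ _ _ "eball 0 (fps_conv_radius B)"])
          (use inv_in nz in \<open>auto intro!: holomorphic_intros\<close>)
      thus "(\<lambda>w. eval_fps B (inverse w)) holomorphic_on S" by (simp add: o_def)
    qed
    show "open S" by (simp add: S_def open_Compl)
    show "connected S" unfolding S_def by (rule connected_complement_bounded_convex) auto
    show "of_real ` {R<..} \<subseteq> S" using R by (auto simp: S_def)
    show "of_real (R + 1) \<in> S" using R by (auto simp: S_def simp del: of_real_add)
    show "complex_of_real (R + 1) islimpt of_real ` {R<..}"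
    proof (rule islimpt_approachable[THEN iffD2], intro allI impI)
      fix d :: real assume "d > 0"
      thus "\<exists>x'\<in>complex_of_real ` {R<..}. x' \<noteq> of_real (R + 1) \<and> dist x' (of_real (R + 1)) < d"
        by (intro bexI[of _ "of_real (R + 1 + d / 2)"])
          (auto simp: dist_norm simp del: of_real_add simp flip: of_real_diff)
    qed
    show "eval_fps A z + eval_fps B (inverse z) = 0" if "z \<in> complex_of_real ` {R<..}" for z
      using that AB by auto
  qed (use w in auto)
  have B_lim: "((\<lambda>w. eval_fps B (inverse w)) \<longlongrightarrow> 0) at_infinity"
  proof -
    have "isCont (eval_fps B) 0"
      by (rule continuous_eval_fps) (use B_pos in \<open>simp add: zero_ereal_def\<close>)
    from isCont_tendsto_compose[OF this tendsto_inverse_0]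
    show ?thesis by (simp add: eval_fps_at_0 B_def)
  qed
  have A0: "eval_fps A w = 0" for w
  proof (rule Liouville_weak_0[of "eval_fps A" w])
    show "eval_fps A holomorphic_on UNIV" by (intro holomorphic_intros) (simp add: A_rad)
    have "eventually (\<lambda>w. - eval_fps B (inverse w) = eval_fps A w) at_infinity"
      unfolding eventually_at_infinity
    proof (intro exI[of _ "R + 1"] allI impI)
      fix w :: complex assume "norm w \<ge> R + 1"
      hence "w \<in> S" by (auto simp: S_def)
      from AB'[OF this] show "- eval_fps B (inverse w) = eval_fps A w"
        by (metis eq_neg_iff_add_eq_0)
    qed
    thus "(eval_fps A \<longlongrightarrow> 0) at_infinity"
      using Lim_transform_eventually[OF tendsto_minus[OF B_lim]] by simp
  qed
  have B0: "eval_fps B u = 0" if u: "norm u < 1 / R" for u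
  proof (cases "u = 0")
    case True thus ?thesis by (simp add: eval_fps_at_0 B_def)
  next
    case False
    have "inverse u \<in> S" using u False R by (auto simp: S_def norm_inverse norm_divide field_simps)
    from AB'[OF this] A0 show ?thesis by simp
  qed
  have "A = 0"
    by (rule eval_fps_eqD) (auto simp: A_rad A0)
  moreover have "B = 0"
  proof (rule eval_fps_eqD)
    show "fps_conv_radius B > 0" by (rule B_pos)
    have "eventually (\<lambda>u. u \<in> ball 0 (1/R)) (nhds (0::complex))"
      by (rule eventually_nhds_in_open) (use R in auto)
    thus "eventually (\<lambda>u. eval_fps B u = eval_fps 0 u) (nhds 0)"
      by eventually_elim (use B0 in auto)
  qed auto
  ultimately have "fps_nth A (nat m) = 0" "fps_nth B (nat (- m)) = 0" by auto
  thus ?thesis by (cases "m \<ge> 0") (auto simp: A_def B_def)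
qed

text \<open>The difference of two candidate coefficient families is a two-sided series with sum 0 on
  a ray, so the description in \<open>laurent_coeff\<close> is unique.\<close>

lemma laurent_coeff_eqI:
  fixes c :: "int \<Rightarrow> real"
  assumes S: "{r<..} \<subseteq> S"
    and c: "\<And>t. t \<in> S \<Longrightarrow> ((\<lambda>m. c m * t powi m) has_sum h t) UNIV"
  shows "laurent_coeff S h = c"
  unfolding laurent_coeff_def
proof (rule the_equality)
  fix d :: "int \<Rightarrow> real"
  assume d: "\<forall>t\<in>S. ((\<lambda>m. d m * t powi m) has_sum h t) UNIV"
  have "d m - c m = 0" for m
  proof (rule two_sided_series_zero[of "max r 1" "\<lambda>m. d m - c m"])
    fix t assume "t > max r 1"
    hence "t \<in> S" using S by auto
    have "((\<lambda>m. d m * t powi m + - (c m * t powi m)) has_sum h t + - h t) UNIV"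
      by (intro has_sum_add has_sum_uminusI) (use d c \<open>t \<in> S\<close> in auto)
    thus "((\<lambda>m. (d m - c m) * t powi m) has_sum 0) UNIV" by (simp add: algebra_simps)
  qed auto
  thus "d = c" by auto
qed (use c in auto)

section \<open>Integrals of Laurent polynomials\<close>

text \<open>A Laurent polynomial as a finite family of terms whose exponents \<open>k a\<close> may
  coincide, so that sums over permutations and signs need not be sorted by exponent;
  \<open>monomial_coeff\<close> collects equal exponents.\<close>

definition monomial_sum :: "'a set \<Rightarrow> ('a \<Rightarrow> real) \<Rightarrow> ('a \<Rightarrow> int) \<Rightarrow> real \<Rightarrow> real" where
  "monomial_sum A c k t = (\<Sum>a\<in>A. c a * t powi k a)"

definition monomial_coeff :: "'a set \<Rightarrow> ('a \<Rightarrow> real) \<Rightarrow> ('a \<Rightarrow> int) \<Rightarrow> int \<Rightarrow> real" where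
  "monomial_coeff A c k m = (\<Sum>a\<in>{a\<in>A. k a = m}. c a)"

text \<open>The index set \<open>M\<close> is arbitrary because \<open>P_integral\<close> sums the
  positive and the negative exponents separately.\<close>

lemma monomial_coeff_has_sum:
  assumes "finite A"
  shows "((\<lambda>m. monomial_coeff A c k m * t powi m) has_sum monomial_sum {a\<in>A. k a \<in> M} c k t) M"
proof (rule has_sum_finite_neutralI[of "k ` {a\<in>A. k a \<in> M}"])
  show "monomial_sum {a\<in>A. k a \<in> M} c k t = (\<Sum>m\<in>k ` {a\<in>A. k a \<in> M}. monomial_coeff A c k m * t powi m)"
    unfolding monomial_sum_def
  proof (subst sum.image_gen[of _ _ k])
    show "(\<Sum>y\<in>k ` {a \<in> A. k a \<in> M}. \<Sum>x | x \<in> {a \<in> A. k a \<in> M} \<and> k x = y. c x * t powi k x) =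
        (\<Sum>m\<in>k ` {a\<in>A. k a \<in> M}. monomial_coeff A c k m * t powi m)"
      unfolding monomial_coeff_def sum_distrib_right
      by (intro sum.cong) auto
  qed (use assms in simp)
  fix m assume "m \<in> M - k ` {a\<in>A. k a \<in> M}"
  hence "{a\<in>A. k a = m} = {}" by auto
  thus "monomial_coeff A c k m * t powi m = 0" unfolding monomial_coeff_def by (simp only: sum.empty)
qed (use assms in auto)

lemma laurent_coeff_monomial_sum:
  assumes "finite A" "{r<..} \<subseteq> S" "\<And>t. t \<in> S \<Longrightarrow> h t = monomial_sum A c k t"
  shows "laurent_coeff S h = monomial_coeff A c k"
  by (rule laurent_coeff_eqI[OF assms(2)])
    (use monomial_coeff_has_sum[OF assms(1), of c k _ UNIV] assms(3) in simp)

text \<open>\<open>h\<close> is known on \<open>S\<close> only, but its coefficients there determine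
  the extension at every \<open>t\<close>.\<close>

lemma laurent_extension_monomial_sum:
  assumes "finite A" "{r<..} \<subseteq> S" "\<And>t. t \<in> S \<Longrightarrow> h t = monomial_sum A c k t"
  shows "laurent_extension S h t = monomial_sum A c k t"
proof -
  have "laurent_coeff S h = monomial_coeff A c k"
    by (rule laurent_coeff_monomial_sum[OF assms])
  thus ?thesis
    using infsumI[OF monomial_coeff_has_sum[OF assms(1), of c k t UNIV]]
    by (simp add: laurent_extension_def)
qed

lemma DERIV_powi:
  fixes t :: real
  assumes "t \<noteq> 0" "k \<noteq> 0"
  shows "((\<lambda>t. t powi k / real_of_int k) has_real_derivative t powi k / t) (at t)"
  using assms by (auto intro!: derivative_eq_intros simp: power_int_diff)

text \<open>The bounds may come in either order: the integral over \<open>w\<close> will run from 1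
  to a \<open>z\<close> that can lie below 1.\<close>

lemma interval_integral_monomial_sum:
  assumes "finite A" "0 < p" "0 < q" "\<And>a. a \<in> A \<Longrightarrow> k a \<noteq> 0"
  shows "(LBINT t=p..q. monomial_sum A c k t / t) =
     (\<Sum>a\<in>A. c a * (q powi k a - p powi k a) / real_of_int (k a))"
proof -
  have "(LBINT t=p..q. monomial_sum A c k t / t) =
      (\<Sum>a\<in>A. c a * (q powi k a / real_of_int (k a))) - (\<Sum>a\<in>A. c a * (p powi k a / real_of_int (k a)))"
  proof (rule interval_integral_FTC_finite)
    show "continuous_on {min p q..max p q} (\<lambda>t. monomial_sum A c k t / t)"
      unfolding monomial_sum_def using assms by (auto intro!: continuous_intros)
    fix t assume "min p q \<le> t" "t \<le> max p q"
    hence t: "t \<noteq> 0" using assms by auto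
    have "((\<lambda>t. \<Sum>a\<in>A. c a * (t powi k a / real_of_int (k a))) has_real_derivative
        (\<Sum>a\<in>A. c a * (t powi k a / t))) (at t)"
      by (intro DERIV_sum DERIV_cmult DERIV_powi t assms(4))
    thus "((\<lambda>t. \<Sum>a\<in>A. c a * (t powi k a / real_of_int (k a))) has_vector_derivative
        monomial_sum A c k t / t) (at t within {min p q..max p q})"
      unfolding monomial_sum_def has_real_derivative_iff_has_vector_derivative
      by (simp add: sum_divide_distrib has_vector_derivative_at_within)
  qed
  also have "\<dots> = (\<Sum>a\<in>A. c a * (q powi k a - p powi k a) / real_of_int (k a))"
    by (simp add: sum_subtractf[symmetric] diff_divide_distrib algebra_simps)
  finally show ?thesis .
qed

text \<open>The antiderivative t^k / k tends to 0 at 0; as the integrand is nonnegative, the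
  fundamental theorem for improper integrals yields integrability together with the value.\<close>

lemma interval_integral_powi_at_0:
  assumes "k > 0"
  shows "set_integrable lborel (einterval 0 1) (\<lambda>t. t powi k / t)"
    "(LBINT t=0..1. t powi k / t) = 1 / real_of_int k"
proof -
  have lim0: "((\<lambda>t::real. t powi k / real_of_int k) \<longlongrightarrow> 0) (at_right 0)"
  proof -
    obtain n where n: "k = int (Suc n)" using assms by (metis gr0_implies_Suc zero_less_imp_eq_int)
    have "((\<lambda>t::real. t ^ Suc n / real (Suc n)) \<longlongrightarrow> 0 ^ Suc n / real (Suc n)) (at_right 0)"
      by (intro tendsto_intros) auto
    thus ?thesis by (simp add: n del: of_nat_Suc)
  qed
  have lim1: "((\<lambda>t::real. t powi k / real_of_int k) \<longlongrightarrow> 1 powi k / real_of_int k) (at_left 1)"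
    by (intro tendsto_intros) (use assms in auto)
  let ?F = "\<lambda>t::real. t powi k / real_of_int k"
  have A: "((?F \<circ> real_of_ereal) \<longlongrightarrow> 0) (at_right (ereal 0))"
    using lim0 by (subst ereal_tendsto_simps)
  have B: "((?F \<circ> real_of_ereal) \<longlongrightarrow> (1 powi k / real_of_int k)) (at_left (ereal 1))"
    using lim1 by (subst ereal_tendsto_simps)
  have 1: "ereal 0 < ereal 1" by simp
  have 2: "(?F has_real_derivative t powi k / t) (at t)" if "ereal 0 < ereal t" "ereal t < ereal 1" for t
    using that assms by (intro DERIV_powi) auto
  have 3: "isCont (\<lambda>t. t powi k / t) t" if "ereal 0 < ereal t" "ereal t < ereal 1" for t
    using that by (intro continuous_intros) auto
  have 4: "AE t in lborel. ereal 0 < ereal t \<longrightarrow> ereal t < ereal 1 \<longrightarrow> 0 \<le> t powi k / t"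
    by (intro AE_I2) auto
  have "set_integrable lborel (einterval (ereal 0) (ereal 1)) (\<lambda>t. t powi k / t) \<and>
    (LBINT t=ereal 0..ereal 1. t powi k / t) = (1 powi k / real_of_int k) - 0"
    using interval_integral_FTC_nonneg[of _ _ ?F "\<lambda>t. t powi k / t", OF 1 2 3 4 A B] by simp
  thus "set_integrable lborel (einterval 0 1) (\<lambda>t. t powi k / t)"
    "(LBINT t=0..1. t powi k / t) = 1 / real_of_int k" by (simp_all add: zero_ereal_def one_ereal_def)
qed

lemma interval_integral_powi_at_infinity:
  assumes "k < 0"
  shows "set_integrable lborel (einterval 1 \<infinity>) (\<lambda>t. t powi k / t)"
    "(LBINT t=1..\<infinity>. t powi k / t) = - 1 / real_of_int k"
proof -
  have lim0: "((\<lambda>t::real. t powi k / real_of_int k) \<longlongrightarrow> 0) at_top"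
  proof -
    obtain n where n: "k = - int (Suc n)" using assms by (metis neg_less_0_iff_less zero_less_imp_eq_int gr0_implies_Suc minus_minus)
    have "((\<lambda>t::real. inverse t ^ Suc n / real_of_int k) \<longlongrightarrow> 0 ^ Suc n / real_of_int k) at_top"
      by (intro tendsto_intros tendsto_inverse_0_at_top filterlim_ident) (use assms in auto)
    thus ?thesis by (simp add: n power_int_minus power_inverse del: of_nat_Suc)
  qed
  have lim1: "((\<lambda>t::real. t powi k / real_of_int k) \<longlongrightarrow> 1 powi k / real_of_int k) (at_right 1)"
    by (intro tendsto_intros) (use assms in auto)
  let ?F = "\<lambda>t::real. t powi k / real_of_int k"
  have A: "((?F \<circ> real_of_ereal) \<longlongrightarrow> (1 powi k / real_of_int k)) (at_right (ereal 1))"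
    using lim1 by (subst ereal_tendsto_simps)
  have B: "((?F \<circ> real_of_ereal) \<longlongrightarrow> 0) (at_left \<infinity>)"
    using lim0 by (subst ereal_tendsto_simps)
  have 1: "ereal 1 < \<infinity>" by simp
  have 2: "(?F has_real_derivative t powi k / t) (at t)" if "ereal 1 < ereal t" "ereal t < \<infinity>" for t
    using that assms by (intro DERIV_powi) auto
  have 3: "isCont (\<lambda>t. t powi k / t) t" if "ereal 1 < ereal t" "ereal t < \<infinity>" for t
    using that by (intro continuous_intros) auto
  have 4: "AE t in lborel. ereal 1 < ereal t \<longrightarrow> ereal t < \<infinity> \<longrightarrow> 0 \<le> t powi k / t"
    by (intro AE_I2) auto
  have "set_integrable lborel (einterval (ereal 1) \<infinity>) (\<lambda>t. t powi k / t) \<and>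
    (LBINT t=ereal 1..\<infinity>. t powi k / t) = 0 - (1 powi k / real_of_int k)"
    using interval_integral_FTC_nonneg[of _ _ ?F "\<lambda>t. t powi k / t", OF 1 2 3 4 A B] by simp
  thus "set_integrable lborel (einterval 1 \<infinity>) (\<lambda>t. t powi k / t)"
    "(LBINT t=1..\<infinity>. t powi k / t) = - 1 / real_of_int k" by (simp_all add: one_ereal_def)
qed

lemma interval_integral_sum_cmult:
  fixes f :: "'a \<Rightarrow> real \<Rightarrow> real"
  assumes "a \<le> b" "\<And>i. i \<in> A \<Longrightarrow> set_integrable lborel (einterval a b) (f i)"
  shows "(LBINT t=a..b. (\<Sum>i\<in>A. c i * f i t)) = (\<Sum>i\<in>A. c i * (LBINT t=a..b. f i t))"
proof -
  have "(LINT t:einterval a b|lborel. (\<Sum>i\<in>A. c i * f i t)) =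
      (LINT t|lborel. (\<Sum>i\<in>A. c i * (indicator (einterval a b) t *\<^sub>R f i t)))"
    unfolding set_lebesgue_integral_def by (simp add: sum_distrib_left algebra_simps)
  also have "\<dots> = (\<Sum>i\<in>A. (LINT t|lborel. c i * (indicator (einterval a b) t *\<^sub>R f i t)))"
    by (rule Bochner_Integration.integral_sum)
      (use assms(2) in \<open>auto simp: set_integrable_def\<close>)
  finally show ?thesis using assms(1)
    by (simp add: interval_lebesgue_integral_def set_lebesgue_integral_def)
qed

text \<open>A term with k > 0 gives 1/k over (0, 1), one with k < 0 gives -1/k over (1, infinity),
  and the minus sign before the second integral turns this into 1/k as well.\<close>

lemma P_integral_monomial_sum:
  assumes "finite A" "\<And>a. a \<in> A \<Longrightarrow> k a \<noteq> 0" "\<And>t. t > 0 \<Longrightarrow> h t = monomial_sum A c k t"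
  shows "P_integral h = (\<Sum>a\<in>A. c a / real_of_int (k a))"
proof -
  have coeff: "laurent_coeff {0<..} h = monomial_coeff A c k"
    by (rule laurent_coeff_monomial_sum[of _ 0]) (use assms in auto)
  \<comment> \<open>No exponent is 0, so the constant coefficient is an empty sum and the defined
    branch of \<open>P_integral\<close> applies.\<close>
  have c0: "monomial_coeff A c k 0 = 0"
  proof -
    have "{a\<in>A. k a = 0} = {}" using assms(2) by auto
    thus ?thesis unfolding monomial_coeff_def by (simp only: sum.empty)
  qed
  have inf: "(\<Sum>\<^sub>\<infinity>m\<in>M. monomial_coeff A c k m * t powi m) / t =
      (\<Sum>a\<in>{a\<in>A. k a \<in> M}. c a * (t powi k a / t))" for t M
    using infsumI[OF monomial_coeff_has_sum[OF assms(1), of c k t M]]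
    by (simp add: monomial_sum_def sum_divide_distrib)
  have "P_integral h = (\<Sum>a\<in>{a\<in>A. k a \<in> {0<..}}. c a * (LBINT t=0..1. t powi k a / t)) -
      (\<Sum>a\<in>{a\<in>A. k a \<in> {..<0}}. c a * (LBINT t=1..\<infinity>. t powi k a / t))"
    unfolding P_integral_def coeff Let_def if_P[OF c0] inf
    by (intro arg_cong2[of _ _ _ _ minus] interval_integral_sum_cmult)
      (auto intro: interval_integral_powi_at_0 interval_integral_powi_at_infinity)
  also have "\<dots> = (\<Sum>a\<in>{a\<in>A. k a \<in> {0<..}}. c a / real_of_int (k a)) +
      (\<Sum>a\<in>{a\<in>A. k a \<in> {..<0}}. c a / real_of_int (k a))"
    by (simp add: interval_integral_powi_at_0 interval_integral_powi_at_infinity sum_negf)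
  also have "\<dots> = (\<Sum>a\<in>{a\<in>A. k a \<in> {0<..}} \<union> {a\<in>A. k a \<in> {..<0}}. c a / real_of_int (k a))"
    by (rule sum.union_disjoint[symmetric]) (use assms(1) in auto)
  also have "{a\<in>A. k a \<in> {0<..}} \<union> {a\<in>A. k a \<in> {..<0}} = A"
    using assms(2) by (auto simp: neq_iff)
  finally show ?thesis .
qed

section \<open>The iterated integral\<close>

text \<open>The inner integral turns u^q into s^q (x_(i+1)^q - x_i^q) / q, so the total exponent of
  s is p + q and the outer integral divides by it. The monomial form of \<open>G\<close> is assumed
  strictly inside the interval, where interlacing holds.\<close>

lemma dY_integral_monomials:
  assumes A: "finite A" and x: "0 < x i" "x i \<le> x (Suc i)"
    and pq: "\<And>a. a \<in> A \<Longrightarrow> q a \<noteq> 0" "\<And>a. a \<in> A \<Longrightarrow> p a + q a \<noteq> 0"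
    and G: "\<And>s u. 0 < s \<Longrightarrow> s * x i < u \<Longrightarrow> u < s * x (Suc i) \<Longrightarrow>
      G (t(i := s)) (y(i := u)) = (\<Sum>a\<in>A. c a * s powi p a * u powi q a)"
  shows "dY_integral x i G t y =
    (\<Sum>a\<in>A. c a * ((x (Suc i) powi q a - x i powi q a) / real_of_int (q a * (p a + q a))))"
proof -
  have inner: "(LBINT u = s * x i..s * x (Suc i). G (t(i := s)) (y(i := u)) / u) =
      monomial_sum A (\<lambda>a. c a * (x (Suc i) powi q a - x i powi q a) / real_of_int (q a)) (\<lambda>a. p a + q a) s"
    if s: "s > 0" for s
  proof -
    have le: "s * x i \<le> s * x (Suc i)" using x s by simp
    have "(LBINT u = s * x i..s * x (Suc i). G (t(i := s)) (y(i := u)) / u) =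
        (LBINT u = s * x i..s * x (Suc i). monomial_sum A (\<lambda>a. c a * s powi p a) q u / u)"
    proof (rule interval_integral_cong)
      fix u assume "u \<in> einterval (min (ereal (s * x i)) (ereal (s * x (Suc i)))) (max (ereal (s * x i)) (ereal (s * x (Suc i))))"
      hence "s * x i < u" "u < s * x (Suc i)" using le by (auto simp: einterval_iff min_def max_def)
      thus "G (t(i := s)) (y(i := u)) / u = monomial_sum A (\<lambda>a. c a * s powi p a) q u / u"
        using G[OF s] by (simp add: monomial_sum_def)
    qed
    also have "\<dots> = (\<Sum>a\<in>A. c a * s powi p a * ((s * x (Suc i)) powi q a - (s * x i) powi q a) / real_of_int (q a))"
      by (rule interval_integral_monomial_sum) (use A x s pq in auto)
    also have "\<dots> = monomial_sum A (\<lambda>a. c a * (x (Suc i) powi q a - x i powi q a) / real_of_int (q a)) (\<lambda>a. p a + q a) s"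
      unfolding monomial_sum_def
      using s by (intro sum.cong) (auto simp: power_int_mult_distrib power_int_add algebra_simps)
    finally show ?thesis .
  qed
  have "dY_integral x i G t y =
      (\<Sum>a\<in>A. c a * (x (Suc i) powi q a - x i powi q a) / real_of_int (q a) / real_of_int (p a + q a))"
    unfolding dY_integral_def
    by (rule P_integral_monomial_sum) (use A pq inner in auto)
  thus ?thesis by (simp add: divide_divide_eq_left)
qed

text \<open>Each term keeps its monomial in the variables below \<open>i\<close> and has one factor
  from \<open>dY_integral_monomials\<close> for every index from \<open>i\<close> on. Interlacing is
  imposed below \<open>i\<close>, where the variables are still free.\<close>

lemma foldr_dY_integral_monomials:
  assumes A: "finite A" and x: "\<And>l. l \<in> {1..<L} \<Longrightarrow> 0 < x l" "\<And>l. l \<in> {1..<L} \<Longrightarrow> x l \<le> x (Suc l)"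
    and pq: "\<And>a l. a \<in> A \<Longrightarrow> l \<in> {1..<L} \<Longrightarrow> q a l \<noteq> 0" "\<And>a l. a \<in> A \<Longrightarrow> l \<in> {1..<L} \<Longrightarrow> p a l + q a l \<noteq> 0"
    and G: "\<And>t y. (\<And>l. l \<in> {1..<L} \<Longrightarrow> 0 < t l \<and> t l * x l < y l \<and> y l < t l * x (Suc l)) \<Longrightarrow>
      G t y = (\<Sum>a\<in>A. c a * (\<Prod>l=1..<L. t l powi p a l * y l powi q a l))"
    and L: "1 \<le> i" "i \<le> L"
    and ty: "\<And>l. l \<in> {1..<i} \<Longrightarrow> 0 < t l \<and> t l * x l < y l \<and> y l < t l * x (Suc l)"
  shows "foldr (dY_integral x) [i..<L] G t y =
    (\<Sum>a\<in>A. c a * (\<Prod>l=i..<L. (x (Suc l) powi q a l - x l powi q a l) / real_of_int (q a l * (p a l + q a l))) *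
        (\<Prod>l=1..<i. t l powi p a l * y l powi q a l))"
  using L(2,1) ty
\<comment> \<open>Downward induction from \<open>L\<close>; \<open>t\<close> and \<open>y\<close>
  stay arbitrary because the next integral updates their entries at \<open>i\<close>.\<close>
proof (induction i arbitrary: t y rule: inc_induct)
  case base
  thus ?case using G[of t y] by simp
next
  case (step i)
  let ?K = "\<lambda>a l. (x (Suc l) powi q a l - x l powi q a l) / real_of_int (q a l * (p a l + q a l))"
  let ?m = "\<lambda>a i t y. \<Prod>l=1..<i. t l powi p a l * y l powi q a l"
  have i: "i \<in> {1..<L}" using step by simp
  have "foldr (dY_integral x) [i..<L] G t y = dY_integral x i (foldr (dY_integral x) [Suc i..<L] G) t y"
    using step by (simp add: upt_conv_Cons)
  also have "\<dots> = (\<Sum>a\<in>A. (c a * (\<Prod>l=Suc i..<L. ?K a l) * ?m a i t y) * ?K a i)"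
  proof (rule dY_integral_monomials)
    fix s u assume su: "0 < s" "s * x i < u" "u < s * x (Suc i)"
    have "foldr (dY_integral x) [Suc i..<L] G (t(i := s)) (y(i := u)) =
        (\<Sum>a\<in>A. c a * (\<Prod>l=Suc i..<L. ?K a l) * ?m a (Suc i) (t(i := s)) (y(i := u)))"
    proof (rule step.IH)
      fix l assume "l \<in> {1..<Suc i}"
      thus "0 < (t(i := s)) l \<and> (t(i := s)) l * x l < (y(i := u)) l \<and> (y(i := u)) l < (t(i := s)) l * x (Suc l)"
        using step.prems(2)[of l] su by (cases "l = i") auto
    qed simp
    also have "\<dots> = (\<Sum>a\<in>A. c a * (\<Prod>l=Suc i..<L. ?K a l) * ?m a i t y * s powi p a i * u powi q a i)"
    proof (rule sum.cong)
      fix a assume "a \<in> A"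
      have "?m a (Suc i) (t(i := s)) (y(i := u)) = ?m a i (t(i := s)) (y(i := u)) * (s powi p a i * u powi q a i)"
        using step.prems(1) by simp
      also have "?m a i (t(i := s)) (y(i := u)) = ?m a i t y"
        by (intro prod.cong) auto
      finally show "c a * (\<Prod>l=Suc i..<L. ?K a l) * ?m a (Suc i) (t(i := s)) (y(i := u)) =
          c a * (\<Prod>l=Suc i..<L. ?K a l) * ?m a i t y * s powi p a i * u powi q a i"
        by (simp only: mult.assoc)
    qed simp
    finally show "foldr (dY_integral x) [Suc i..<L] G (t(i := s)) (y(i := u)) =
        (\<Sum>a\<in>A. c a * (\<Prod>l=Suc i..<L. ?K a l) * ?m a i t y * s powi p a i * u powi q a i)" .
  qed (use A x[OF i] pq[OF _ i] in auto)
  also have "\<dots> = (\<Sum>a\<in>A. c a * (\<Prod>l=i..<L. ?K a l) * ?m a i t y)"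
    using step.hyps by (intro sum.cong) (auto simp: prod.atLeast_Suc_lessThan[of i L])
  finally show ?case .
qed

text \<open>The integrand will involve \<open>symp_char\<close>, a limit; it is only required to
  agree on the domain of integration with a measurable function, later an alternant.\<close>

lemma set_integral_return:
  fixes g :: "real \<Rightarrow> real"
  assumes "A \<in> sets borel" "s \<in> A" "h \<in> borel_measurable borel" "\<And>v. v \<in> A \<Longrightarrow> g v = h v"
  shows "(LINT v:A|return borel s. g v) = h s"
proof -
  have "(LINT v:A|return borel s. g v) = (LINT v|return borel s. indicator A v *\<^sub>R h v)"
    unfolding set_lebesgue_integral_def using assms(4)
    by (intro Bochner_Integration.integral_cong) (auto simp: indicator_def)
  also have "\<dots> = indicator A s *\<^sub>R h s"
    by (rule integral_return) (use assms in auto)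
  finally show ?thesis using assms(2) by simp
qed

section \<open>Expansion of alternants into signed monomials\<close>

definition perm_exponent :: "(nat \<Rightarrow> nat) \<Rightarrow> (nat \<Rightarrow> nat) \<Rightarrow> nat \<Rightarrow> int" where
  "perm_exponent mu \<sigma> l = int (mu (Suc (\<sigma> (l - 1))))"

lemma alternant_leibniz:
  "alternant L mu y = (\<Sum>\<sigma> | \<sigma> permutes {0..<L}. signof \<sigma> *
     (\<Prod>l=1..<Suc L. y l powi perm_exponent mu \<sigma> l - y l powi (- perm_exponent mu \<sigma> l)))"
proof -
  have "(\<Prod>i = 0..<L. Matrix.mat L L (\<lambda>(i, j). y (Suc i) powi int (mu (Suc j)) - y (Suc i) powi (- int (mu (Suc j)))) $$ (i, \<sigma> i)) =
     (\<Prod>l=1..<Suc L. y l powi perm_exponent mu \<sigma> l - y l powi (- perm_exponent mu \<sigma> l))"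
    if "\<sigma> permutes {0..<L}" for \<sigma>
    unfolding One_nat_def prod.atLeast_Suc_lessThan_Suc_shift
    using permutes_in_image[OF that] by (intro prod.cong) (auto simp: perm_exponent_def)
  thus ?thesis unfolding alternant_def by (subst det_def'[of _ L]) auto
qed

lemma alternant_measurable:
  "(\<lambda>v. alternant L mu (y(i := v))) \<in> borel_measurable borel"
proof -
  have [measurable]: "(\<lambda>v. (y(i := v)) l) \<in> borel_measurable borel" for l
    by (cases "l = i") auto
  have [measurable]: "(\<lambda>v. f v powi k) \<in> borel_measurable borel" if [measurable]: "f \<in> borel_measurable borel"
    for f :: "real \<Rightarrow> real" and k
    unfolding power_int_def by measurable
  show ?thesis unfolding alternant_leibniz by measurable
qed

definition signs :: "int set" where "signs = {1, -1}"

lemma sum_signs: "(\<Sum>e\<in>signs. f e) = f 1 + (f (- 1) :: 'a::comm_monoid_add)"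
  by (simp add: signs_def)

lemma prod_last:
  fixes f :: "nat \<Rightarrow> 'a::comm_monoid_mult"
  assumes "1 \<le> L"
  shows "(\<Prod>l=1..<Suc L. f l) = (\<Prod>l=1..<L. f l) * f L"
  using assms by simp

text \<open>Index set of the monomials of an alternant: a permutation, the sign \<open>e\<close> of
  the exponent of y_L and the signs \<open>g\<close> of the others. The sign \<open>e\<close> is
  kept apart because y_L is eliminated first.\<close>

definition signed_perms :: "nat \<Rightarrow> ((nat \<Rightarrow> nat) \<times> int \<times> (nat \<Rightarrow> int)) set" where
  "signed_perms L = {\<sigma>. \<sigma> permutes {0..<L}} \<times> signs \<times> PiE {1..<L} (\<lambda>_. signs)"

lemma finite_signed_perms: "finite (signed_perms L)"
  unfolding signed_perms_def signs_def by (intro finite_cartesian_product finite_PiE finite_permutations) auto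

text \<open>Distributivity, used from right to left to expand an alternant into monomials and from
  left to right to regroup the integrated terms.\<close>

lemma sum_signed_perms:
  "(\<Sum>(\<sigma>, e, g)\<in>signed_perms L. c \<sigma> e * (\<Prod>l=1..<L. F \<sigma> e l (g l))) =
   (\<Sum>\<sigma> | \<sigma> permutes {0..<L}. \<Sum>e\<in>signs. c \<sigma> e * (\<Prod>l=1..<L. \<Sum>s\<in>signs. F \<sigma> e l s :: real))"
proof -
  have "(\<Prod>l=1..<L. \<Sum>s\<in>signs. F \<sigma> e l s) = (\<Sum>g\<in>PiE {1..<L} (\<lambda>_. signs). \<Prod>l=1..<L. F \<sigma> e l (g l))" for \<sigma> e
    by (rule prod_sum_PiE) (auto simp: signs_def)
  thus ?thesis
    by (simp add: signed_perms_def sum.cartesian_product[symmetric] sum_distrib_left)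
qed

lemma alternant_signed_perms:
  assumes "1 \<le> L"
  shows "alternant L mu y = (\<Sum>(\<sigma>, e, g)\<in>signed_perms L.
     (signof \<sigma> * of_int e * y L powi (e * perm_exponent mu \<sigma> L)) *
     (\<Prod>l=1..<L. of_int (g l) * y l powi (g l * perm_exponent mu \<sigma> l)))"
proof -
  have "alternant L mu y = (\<Sum>\<sigma> | \<sigma> permutes {0..<L}. \<Sum>e\<in>signs.
      (signof \<sigma> * of_int e * y L powi (e * perm_exponent mu \<sigma> L)) *
      (\<Prod>l=1..<L. \<Sum>s\<in>signs. of_int s * y l powi (s * perm_exponent mu \<sigma> l)))"
    unfolding alternant_leibniz prod_last[OF assms]
    by (intro sum.cong) (auto simp: sum_signs algebra_simps)
  thus ?thesis
    unfolding sum_signed_perms[where F = "\<lambda>\<sigma> e l s. of_int s * y l powi (s * perm_exponent mu \<sigma> l)"] .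
qed

lemma power_int_prod: "(\<Prod>i\<in>A. f i) powi n = (\<Prod>i\<in>A. f i powi n :: real)"
  by (induction A rule: infinite_finite_induct) (auto simp: power_int_mult_distrib)

section \<open>The point masses in the last variable\<close>

lemma interlacing_pos: "0 < t \<Longrightarrow> 0 < x \<Longrightarrow> t * x < y \<Longrightarrow> 0 < (y :: real)"
  by (meson less_trans mult_pos_pos)

text \<open>Interlacing puts each factor between x_l / x_(l+1) and 1, and the product of the lower
  bounds telescopes to x_1 / x_L.\<close>

lemma interlacing_product_bounds:
  fixes x t y :: "nat \<Rightarrow> real"
  assumes L: "1 \<le> L" and x: "\<And>l. l \<in> {1..L} \<Longrightarrow> 0 < x l"
    and ty: "\<And>l. l \<in> {1..<L} \<Longrightarrow> 0 < t l \<and> t l * x l < y l \<and> y l < t l * x (Suc l)"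
  shows "(\<Prod>l=1..<L. x l * t l / y l) \<le> 1" "x 1 / x L \<le> (\<Prod>l=1..<L. x l * t l / y l)"
proof -
  have pos: "0 < x l" "0 < x (Suc l)" "0 < t l" "0 < y l" "t l * x l < y l" "y l < t l * x (Suc l)"
    if "l \<in> {1..<L}" for l
    using ty[OF that] x[of l] x[of "Suc l"] that by (auto intro: interlacing_pos[of "t l" "x l"])
  show "(\<Prod>l=1..<L. x l * t l / y l) \<le> 1"
    by (rule prod_le_1) (use pos in \<open>auto simp: field_simps intro: less_imp_le\<close>)
  have "x 1 / x L = (\<Prod>l=1..<L. x l / x (Suc l))"
    using L x
  proof (induction L rule: dec_induct)
    case base
    thus ?case by simp
  next
    case (step n)
    have nz: "x n \<noteq> 0" "x (Suc n) \<noteq> 0"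
      using step.prems[of n] step.prems[of "Suc n"] step.hyps by auto
    have "(\<Prod>l=1..<Suc n. x l / x (Suc l)) = x 1 / x n * (x n / x (Suc n))"
      using step by simp
    thus ?case using nz by simp
  qed
  also have "\<dots> \<le> (\<Prod>l=1..<L. x l * t l / y l)"
  proof (rule prod_mono)
    fix l assume "l \<in> {1..<L}"
    from pos[OF this] show "0 \<le> x l / x (Suc l) \<and> x l / x (Suc l) \<le> x l * t l / y l"
      by (auto simp: field_simps)
  qed
  finally show "x 1 / x L \<le> (\<Prod>l=1..<L. x l * t l / y l)" .
qed

text \<open>With \<open>T\<close> the product of the t_l and \<open>r\<close> that of the x_l t_l /
  y_l, the masses sit at w x_L T r and x_L T r / w. The first lies beyond T x_L because x_1 / x_L
  \<le> r and w > x_L / x_1 give w r > 1; the second lies below T x_1 because r \<le> 1.\<close>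

lemma yL_integral_eq_alternant:
  fixes x t y :: "nat \<Rightarrow> real"
  assumes L: "1 \<le> L" and x: "\<And>l. l \<in> {1..L} \<Longrightarrow> 0 < x l" and w: "x L / x 1 < w"
    and F: "\<And>y. (\<And>l. l \<in> {1..L} \<Longrightarrow> 0 < y l) \<Longrightarrow> F y = alternant L mu y"
    and ty: "\<And>l. l \<in> {1..<L} \<Longrightarrow> 0 < t l \<and> t l * x l < y l \<and> y l < t l * x (Suc l)"
  shows "yL_integral L x w F t y =
     alternant L mu (y(L := w * x L * (\<Prod>l=1..<L. x l * (t l)\<^sup>2 / y l))) +
     alternant L mu (y(L := x L / w * (\<Prod>l=1..<L. x l * (t l)\<^sup>2 / y l)))"
proof -
  define T r where "T = (\<Prod>l=1..<L. t l)" and "r = (\<Prod>l=1..<L. x l * t l / y l)"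
  have P: "(\<Prod>l=1..<L. x l * (t l)\<^sup>2 / y l) = T * r"
    unfolding T_def r_def prod.distrib[symmetric] by (simp add: power2_eq_square algebra_simps)
  have ypos: "0 < y l" if "l \<in> {1..<L}" for l
    using ty[OF that] x[of l] that by (auto intro: interlacing_pos[of "t l" "x l"])
  have T: "0 < T" unfolding T_def using ty by (intro prod_pos) auto
  have x1L: "0 < x 1" "0 < x L" using x L by auto
  have r: "r \<le> 1" "x 1 / x L \<le> r"
    unfolding r_def using interlacing_product_bounds[of L x t y] L x ty by blast+
  have r0: "0 < r" using r(2) x1L by (smt (verit) divide_pos_pos)
  have w0: "0 < w" using w x1L by (smt (verit) divide_pos_pos)
  have "1 < w * (x 1 / x L)" using w x1L by (simp add: field_simps)
  also have "\<dots> \<le> w * r" using r w0 by (intro mult_left_mono) auto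
  finally have wr: "1 < w * r" .
  have s1: "T * x L < w * x L * (T * r)"
    using mult_strict_left_mono[OF wr, of "T * x L"] T x1L by (simp add: mult_ac)
  have s2: "x L / w * (T * r) < T * x 1" "0 < x L / w * (T * r)"
  proof -
    have "x L * r \<le> x L * 1" using r x1L by (intro mult_left_mono) auto
    also have "\<dots> < w * x 1" using w x1L by (simp add: field_simps)
    finally have "T * (x L * r) < T * (w * x 1)" using T by simp
    thus "x L / w * (T * r) < T * x 1" using w0 by (simp add: field_simps)
    show "0 < x L / w * (T * r)" using w0 x1L T r0 by simp
  qed
  have Fv: "F (y(L := v)) = alternant L mu (y(L := v))" if "0 < v" for v
    by (rule F) (use that ypos in auto)
  have "(LINT v:{T * x L<..}|return borel (w * x L * (T * r)). F (y(L := v))) =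
      alternant L mu (y(L := w * x L * (T * r)))"
  proof (rule set_integral_return[where h = "\<lambda>v. alternant L mu (y(L := v))"])
    show "w * x L * (T * r) \<in> {T * x L<..}" using s1 by simp
    show "(\<lambda>v. alternant L mu (y(L := v))) \<in> borel_measurable borel" by (rule alternant_measurable)
    fix v assume "v \<in> {T * x L<..}"
    moreover have "0 < T * x L" using T x1L by simp
    ultimately have "0 < v" unfolding greaterThan_iff by linarith
    thus "F (y(L := v)) = alternant L mu (y(L := v))" by (rule Fv)
  qed simp
  moreover have "(LINT v:{0<..<T * x 1}|return borel (x L / w * (T * r)). F (y(L := v))) =
      alternant L mu (y(L := x L / w * (T * r)))"
  proof (rule set_integral_return[where h = "\<lambda>v. alternant L mu (y(L := v))"])
    show "x L / w * (T * r) \<in> {0<..<T * x 1}" using s2 by simp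
    show "(\<lambda>v. alternant L mu (y(L := v))) \<in> borel_measurable borel" by (rule alternant_measurable)
    show "F (y(L := v)) = alternant L mu (y(L := v))" if "v \<in> {0<..<T * x 1}" for v
      using that by (intro Fv) simp
  qed simp
  ultimately show ?thesis unfolding yL_integral_def P T_def[symmetric] by simp
qed

text \<open>Substituting the point mass into y_L^n spreads the exponent: x_l gets n, t_l gets 2n and
  y_l gets -n. The two masses differ only in w^n against w^(-n).\<close>

lemma yL_integral_monomials:
  fixes x t y :: "nat \<Rightarrow> real"
  assumes L: "1 \<le> L" and x: "\<And>l. l \<in> {1..L} \<Longrightarrow> 0 < x l" and w: "x L / x 1 < w"
    and F: "\<And>y. (\<And>l. l \<in> {1..L} \<Longrightarrow> 0 < y l) \<Longrightarrow> F y = alternant L mu y"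
    and ty: "\<And>l. l \<in> {1..<L} \<Longrightarrow> 0 < t l \<and> t l * x l < y l \<and> y l < t l * x (Suc l)"
  shows "yL_integral L x w F t y = (\<Sum>(\<sigma>, e, g)\<in>signed_perms L.
     let n = e * perm_exponent mu \<sigma> L in
       (signof \<sigma> * of_int e * x L powi n * (w powi n + w powi (- n)) * (\<Prod>l=1..<L. of_int (g l) * x l powi n)) *
       (\<Prod>l=1..<L. t l powi (2 * n) * y l powi (g l * perm_exponent mu \<sigma> l - n)))"
proof -
  define P where "P = (\<Prod>l=1..<L. x l * (t l)\<^sup>2 / y l)"
  have ypos: "0 < y l" if "l \<in> {1..<L}" for l
    using ty[OF that] x[of l] that by (auto intro: interlacing_pos[of "t l" "x l"])
  have alt: "alternant L mu (y(L := s)) = (\<Sum>(\<sigma>, e, g)\<in>signed_perms L.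
     (signof \<sigma> * of_int e * s powi (e * perm_exponent mu \<sigma> L)) *
     (\<Prod>l=1..<L. of_int (g l) * y l powi (g l * perm_exponent mu \<sigma> l)))" for s
    unfolding alternant_signed_perms[OF L] by (intro sum.cong prod.cong) auto
  have main: "P powi n * (\<Prod>l=1..<L. of_int (g l) * y l powi (k l)) =
      (\<Prod>l=1..<L. of_int (g l) * x l powi n) * (\<Prod>l=1..<L. t l powi (2 * n) * y l powi (k l - n))"
    for n and g k :: "nat \<Rightarrow> int"
    unfolding P_def power_int_prod prod.distrib[symmetric]
  proof (rule prod.cong)
    fix l assume l: "l \<in> {1..<L}"
    have "t l powi (2 * n) = (t l)\<^sup>2 powi n" by (simp add: power_int_mult)
    moreover have "y l \<noteq> 0" using ypos[OF l] by simp
    ultimately show "(x l * (t l)\<^sup>2 / y l) powi n * (of_int (g l) * y l powi k l) =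
        of_int (g l) * x l powi n * (t l powi (2 * n) * y l powi (k l - n))"
      by (simp add: power_int_mult_distrib power_int_divide_distrib power_int_diff)
  qed simp
  have s1: "(w * x L * P) powi n = x L powi n * w powi n * P powi n" for n
    by (simp add: power_int_mult_distrib)
  have s2: "(x L / w * P) powi n = x L powi n * w powi (- n) * P powi n" for n
    by (simp only: power_int_mult_distrib power_int_divide_distrib power_int_minus) (simp only: divide_inverse)
  have yL: "yL_integral L x w F t y = alternant L mu (y(L := w * x L * P)) + alternant L mu (y(L := x L / w * P))"
    unfolding P_def by (rule yL_integral_eq_alternant; fact)
  show ?thesis
    unfolding yL alt sum.distrib[symmetric] Let_def
  proof (intro sum.cong refl, clarify)
    fix \<sigma> e g assume "(\<sigma>, e, g) \<in> signed_perms L"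
    let ?n = "e * perm_exponent mu \<sigma> L"
    let ?Y = "\<Prod>l=1..<L. of_int (g l) * y l powi (g l * perm_exponent mu \<sigma> l)"
    have "signof \<sigma> * of_int e * (w * x L * P) powi ?n * ?Y + signof \<sigma> * of_int e * (x L / w * P) powi ?n * ?Y =
        (signof \<sigma> * of_int e * x L powi ?n * (w powi ?n + w powi (- ?n))) * (P powi ?n * ?Y)"
      unfolding s1 s2 by (simp add: algebra_simps)
    thus "signof \<sigma> * of_int e * (w * x L * P) powi ?n * ?Y + signof \<sigma> * of_int e * (x L / w * P) powi ?n * ?Y =
        (signof \<sigma> * of_int e * x L powi ?n * (w powi ?n + w powi (- ?n)) * (\<Prod>l=1..<L. of_int (g l) * x l powi ?n)) *
       (\<Prod>l=1..<L. t l powi (2 * ?n) * y l powi (g l * perm_exponent mu \<sigma> l - ?n))"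
      unfolding main by (simp only: mult.assoc)
  qed
qed

section \<open>The Laurent polynomial in w\<close>

definition D_weight :: "nat \<Rightarrow> (nat \<Rightarrow> nat) \<Rightarrow> (nat \<Rightarrow> real) \<Rightarrow> (nat \<Rightarrow> nat) \<Rightarrow> int \<Rightarrow> real" where
  "D_weight L mu x \<sigma> e = (let n = e * perm_exponent mu \<sigma> L; k = perm_exponent mu \<sigma> in
     signof \<sigma> * of_int e * x L powi n *
     (\<Prod>l=1..<L. (x l powi n * x (Suc l) powi (- n) * (x (Suc l) powi k l - x (Suc l) powi (- k l)) -
        (x l powi k l - x l powi (- k l))) / of_int ((k l)\<^sup>2 - n\<^sup>2)))"

text \<open>Distinct positive parts differ even up to sign. Used with \<open>e\<close> and with
  \<open>- e\<close>, this keeps both s k - n and s k + n away from 0, where n is the exponent of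
  y_L.\<close>

lemma perm_exponent_distinct:
  assumes "inj_on mu {1..L}" "\<And>j. j \<in> {1..L} \<Longrightarrow> 0 < mu j" "\<sigma> permutes {0..<L}" "l \<in> {1..<L}"
    "e \<in> signs" "s \<in> signs"
  shows "perm_exponent mu \<sigma> L > 0" "s * perm_exponent mu \<sigma> l \<noteq> e * perm_exponent mu \<sigma> L"
proof -
  have in_L: "\<sigma> (l - 1) < L" "\<sigma> (L - 1) < L" using permutes_in_image[OF assms(3), of "l - 1"] permutes_in_image[OF assms(3), of "L - 1"] assms(4)
    by auto
  have "\<sigma> (l - 1) \<noteq> \<sigma> (L - 1)"
  proof
    assume "\<sigma> (l - 1) = \<sigma> (L - 1)"
    hence "l - 1 = L - 1" by (rule injD[OF permutes_inj[OF assms(3)]])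
    thus False using assms(4) by auto
  qed
  hence "mu (Suc (\<sigma> (l - 1))) \<noteq> mu (Suc (\<sigma> (L - 1)))"
    using inj_onD[OF assms(1), of "Suc (\<sigma> (l - 1))" "Suc (\<sigma> (L - 1))"] in_L by auto
  hence ne: "perm_exponent mu \<sigma> l \<noteq> perm_exponent mu \<sigma> L" by (simp add: perm_exponent_def)
  have "0 < mu (Suc (\<sigma> (l - 1)))" "0 < mu (Suc (\<sigma> (L - 1)))"
    using in_L by (intro assms(2); simp)+
  hence pos: "0 < perm_exponent mu \<sigma> l" "0 < perm_exponent mu \<sigma> L" by (simp_all add: perm_exponent_def)
  show "perm_exponent mu \<sigma> L > 0" by (rule pos)
  have "e = 1 \<or> e = - 1" "s = 1 \<or> s = - 1" using assms(5,6) by (simp_all add: signs_def)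
  thus "s * perm_exponent mu \<sigma> l \<noteq> e * perm_exponent mu \<sigma> L" using ne pos by (elim disjE) simp_all
qed

text \<open>With p = 2n and q = s k - n, the denominator q (p + q) of each double integral is k^2 -
  n^2 for both signs s. The two signs thus combine over a common denominator to the factors in
  \<open>D_weight\<close>.\<close>

lemma D_integral_eq:
  fixes x :: "nat \<Rightarrow> real"
  assumes L: "1 \<le> L" and x: "\<And>l. l \<in> {1..L} \<Longrightarrow> 0 < x l" "\<And>l. l \<in> {1..<L} \<Longrightarrow> x l \<le> x (Suc l)"
    and w: "x L / x 1 < w" and mu: "inj_on mu {1..L}" "\<And>j. j \<in> {1..L} \<Longrightarrow> 0 < mu j"
    and F: "\<And>y. (\<And>l. l \<in> {1..L} \<Longrightarrow> 0 < y l) \<Longrightarrow> F y = alternant L mu y"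
  shows "D_integral L x w F = (\<Sum>\<sigma> | \<sigma> permutes {0..<L}. \<Sum>e\<in>signs.
     D_weight L mu x \<sigma> e * (w powi (e * perm_exponent mu \<sigma> L) + w powi (- (e * perm_exponent mu \<sigma> L))))"
proof -
  let ?n = "\<lambda>\<sigma> e. e * perm_exponent mu \<sigma> L"
  let ?q = "\<lambda>(\<sigma>, e, g) l. g l * perm_exponent mu \<sigma> l - ?n \<sigma> e"
  let ?p = "\<lambda>(\<sigma>, e, g :: nat \<Rightarrow> int) l::nat. 2 * ?n \<sigma> e"
  let ?C = "\<lambda>\<sigma> e. signof \<sigma> * of_int e * x L powi ?n \<sigma> e * (w powi ?n \<sigma> e + w powi (- ?n \<sigma> e))"
  let ?c = "\<lambda>(\<sigma>, e, g). ?C \<sigma> e * (\<Prod>l=1..<L. of_int (g l) * x l powi ?n \<sigma> e)"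
  let ?K = "\<lambda>\<sigma> e l s. (x (Suc l) powi (s * perm_exponent mu \<sigma> l - ?n \<sigma> e) - x l powi (s * perm_exponent mu \<sigma> l - ?n \<sigma> e)) /
      real_of_int ((s * perm_exponent mu \<sigma> l - ?n \<sigma> e) * (2 * ?n \<sigma> e + (s * perm_exponent mu \<sigma> l - ?n \<sigma> e)))"
  have "D_integral L x w F = (\<Sum>a\<in>signed_perms L. ?c a *
      (\<Prod>l=1..<L. (x (Suc l) powi ?q a l - x l powi ?q a l) / real_of_int (?q a l * (?p a l + ?q a l))) *
      (\<Prod>l=1..<1. 1 powi ?p a l * 1 powi ?q a l))"
    unfolding D_integral_def
  proof (rule foldr_dY_integral_monomials)
    fix a l assume a: "a \<in> signed_perms L" and l: "l \<in> {1..<L}"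
    obtain \<sigma> e g where [simp]: "a = (\<sigma>, e, g)" by (cases a)
    have s: "\<sigma> permutes {0..<L}" "e \<in> signs" "g l \<in> signs"
      using a PiE_mem[OF _ l, of g "\<lambda>_. signs"] by (auto simp: signed_perms_def)
    \<comment> \<open>Here p + q is s k + n, that is, s k - n for the opposite sign of
      \<open>e\<close>.\<close>
    have e': "- e \<in> signs" using s by (auto simp: signs_def)
    show "?q a l \<noteq> 0" using perm_exponent_distinct(2)[OF mu s(1) l s(2) s(3)] by simp
    show "?p a l + ?q a l \<noteq> 0" using perm_exponent_distinct(2)[OF mu s(1) l e' s(3)] by simp
  next
    fix t y assume ty: "\<And>l. l \<in> {1..<L} \<Longrightarrow> 0 < t l \<and> t l * x l < y l \<and> y l < t l * x (Suc l)"
    have "yL_integral L x w F t y = (\<Sum>(\<sigma>, e, g)\<in>signed_perms L.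
      let n = ?n \<sigma> e in
        (signof \<sigma> * of_int e * x L powi n * (w powi n + w powi (- n)) * (\<Prod>l=1..<L. of_int (g l) * x l powi n)) *
        (\<Prod>l=1..<L. t l powi (2 * n) * y l powi (g l * perm_exponent mu \<sigma> l - n)))"
      by (rule yL_integral_monomials; fact)
    thus "yL_integral L x w F t y = (\<Sum>a\<in>signed_perms L. ?c a * (\<Prod>l=1..<L. t l powi ?p a l * y l powi ?q a l))"
      by (simp only: Let_def split_def)
  next
    show "finite (signed_perms L)" by (rule finite_signed_perms)
    show "0 < x l" if "l \<in> {1..<L}" for l using x(1) that by simp
    show "x l \<le> x (Suc l)" if "l \<in> {1..<L}" for l using that by (rule x(2))
    show "(1::nat) \<le> 1" "1 \<le> L" using L by simp_all
    show "0 < (1::real) \<and> 1 * x l < 1 \<and> 1 < 1 * x (Suc l)" if "l \<in> {1..<1}" for l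
      using that by simp
  qed
  also have "\<dots> = (\<Sum>(\<sigma>, e, g)\<in>signed_perms L. ?C \<sigma> e * (\<Prod>l=1..<L. of_int (g l) * x l powi ?n \<sigma> e * ?K \<sigma> e l (g l)))"
    by (rule sum.cong[OF refl]) (simp only: split_paired_all split_conv prod.distrib mult.assoc
      atLeastLessThan_empty order_refl prod.empty mult_1_right)
  also have "\<dots> = (\<Sum>\<sigma> | \<sigma> permutes {0..<L}. \<Sum>e\<in>signs. ?C \<sigma> e *
      (\<Prod>l=1..<L. \<Sum>s\<in>signs. of_int s * x l powi ?n \<sigma> e * ?K \<sigma> e l s))"
    by (rule sum_signed_perms[where c = ?C and
      F = "\<lambda>\<sigma> e l s. of_int s * x l powi ?n \<sigma> e * ?K \<sigma> e l s"])
  also have "\<dots> = (\<Sum>\<sigma> | \<sigma> permutes {0..<L}. \<Sum>e\<in>signs.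
     D_weight L mu x \<sigma> e * (w powi ?n \<sigma> e + w powi (- ?n \<sigma> e)))"
  proof (intro sum.cong refl)
    fix \<sigma> e assume s: "\<sigma> \<in> {\<sigma>. \<sigma> permutes {0..<L}}" "e \<in> signs"
    define n where "n = ?n \<sigma> e"
    define k where "k = perm_exponent mu \<sigma>"
    have fac: "(\<Sum>s\<in>signs. of_int s * x l powi n * ((x (Suc l) powi (s * k l - n) - x l powi (s * k l - n)) /
        real_of_int ((s * k l - n) * (2 * n + (s * k l - n))))) =
      (x l powi n * x (Suc l) powi (- n) * (x (Suc l) powi k l - x (Suc l) powi (- k l)) -
        (x l powi k l - x l powi (- k l))) / of_int ((k l)\<^sup>2 - n\<^sup>2)" if l: "l \<in> {1..<L}" for l
    proof -
      have nz: "x l \<noteq> 0" "x (Suc l) \<noteq> 0" using x(1)[of l] x(1)[of "Suc l"] l by auto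
      have den: "(s * k l - n) * (2 * n + (s * k l - n)) = (k l)\<^sup>2 - n\<^sup>2" if "s \<in> signs" for s
        using that by (auto simp: signs_def power2_eq_square algebra_simps)
      have ex: "x l powi n * (x (Suc l) powi (m - n) - x l powi (m - n)) =
          x l powi n * x (Suc l) powi (- n) * x (Suc l) powi m - x l powi m" for m
        using nz by (simp add: power_int_diff power_int_minus divide_inverse right_diff_distrib)
      have "(\<Sum>s\<in>signs. of_int s * x l powi n * ((x (Suc l) powi (s * k l - n) - x l powi (s * k l - n)) /
        real_of_int ((s * k l - n) * (2 * n + (s * k l - n))))) =
        (\<Sum>s\<in>signs. of_int s * (x l powi n * x (Suc l) powi (- n) * x (Suc l) powi (s * k l) - x l powi (s * k l))
          / of_int ((k l)\<^sup>2 - n\<^sup>2))"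
        unfolding ex[symmetric] by (rule sum.cong[OF refl]) (simp only: den times_divide_eq_right mult.assoc)
      also have "\<dots> = (x l powi n * x (Suc l) powi (- n) * (x (Suc l) powi k l - x (Suc l) powi (- k l)) -
        (x l powi k l - x l powi (- k l))) / of_int ((k l)\<^sup>2 - n\<^sup>2)"
      proof -
        have "of_int 1 * (a - b) / d + of_int (- 1) * (a' - b') / d = ((a - a') - (b - b')) / d"
          for a b a' b' d :: real by (simp add: diff_divide_distrib)
        from this[of "x l powi n * x (Suc l) powi (- n) * x (Suc l) powi k l" "x l powi k l"
          "of_int ((k l)\<^sup>2 - n\<^sup>2)" "x l powi n * x (Suc l) powi (- n) * x (Suc l) powi (- k l)" "x l powi (- k l)"]
        show ?thesis unfolding sum_signs mult_1 mult_minus1 right_diff_distrib .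
      qed
      finally show ?thesis .
    qed
    have "(\<Prod>l=1..<L. \<Sum>s\<in>signs. of_int s * x l powi n * ((x (Suc l) powi (s * k l - n) - x l powi (s * k l - n)) /
        real_of_int ((s * k l - n) * (2 * n + (s * k l - n))))) =
      (\<Prod>l=1..<L. (x l powi n * x (Suc l) powi (- n) * (x (Suc l) powi k l - x (Suc l) powi (- k l)) -
        (x l powi k l - x l powi (- k l))) / of_int ((k l)\<^sup>2 - n\<^sup>2))"
      by (rule prod.cong[OF refl fac])
    hence prod: "(\<Prod>l=1..<L. \<Sum>s\<in>signs. of_int s * x l powi ?n \<sigma> e * ?K \<sigma> e l s) =
      (\<Prod>l=1..<L. (x l powi n * x (Suc l) powi (- n) * (x (Suc l) powi k l - x (Suc l) powi (- k l)) -
        (x l powi k l - x l powi (- k l))) / of_int ((k l)\<^sup>2 - n\<^sup>2))"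
      unfolding n_def k_def .
    have "a * b * p = a * p * b" for a b p :: real by simp
    thus "?C \<sigma> e * (\<Prod>l=1..<L. \<Sum>s\<in>signs. of_int s * x l powi ?n \<sigma> e * ?K \<sigma> e l s) =
        D_weight L mu x \<sigma> e * (w powi ?n \<sigma> e + w powi (- ?n \<sigma> e))"
      unfolding D_weight_def Let_def prod n_def k_def .
  qed
  finally show ?thesis .
qed

text \<open>The Laurent polynomial known for w > x_L / x_1 is integrated from 1 to z through its
  extension. Its terms w^n and w^(-n) are told apart by the third component \<open>s\<close> of the
  index set \<open>A\<close>.\<close>

lemma integral_laurent_extension_D_integral:
  fixes x :: "nat \<Rightarrow> real"
  assumes L: "1 \<le> L" and x: "\<And>l. l \<in> {1..L} \<Longrightarrow> 0 < x l" "\<And>l. l \<in> {1..<L} \<Longrightarrow> x l \<le> x (Suc l)"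
    and mu: "inj_on mu {1..L}" "\<And>j. j \<in> {1..L} \<Longrightarrow> 0 < mu j"
    and F: "\<And>y. (\<And>l. l \<in> {1..L} \<Longrightarrow> 0 < y l) \<Longrightarrow> F y = alternant L mu y"
    and z: "0 < z"
  shows "(LBINT w=1..z. laurent_extension {x L / x 1<..} (\<lambda>w. D_integral L x w F) w / w) =
    (\<Sum>\<sigma> | \<sigma> permutes {0..<L}. \<Sum>e\<in>signs. D_weight L mu x \<sigma> e *
       (z powi (e * perm_exponent mu \<sigma> L) - z powi (- (e * perm_exponent mu \<sigma> L))) /
       of_int (e * perm_exponent mu \<sigma> L))"
proof -
  define A where "A = {\<sigma>. \<sigma> permutes {0..<L}} \<times> signs \<times> signs"
  define c where "c = (\<lambda>(\<sigma>, e, s :: int). D_weight L mu x \<sigma> e)"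
  define k where "k = (\<lambda>(\<sigma>, e, s). s * (e * perm_exponent mu \<sigma> L))"
  have finA: "finite A" unfolding A_def signs_def by (intro finite_cartesian_product finite_permutations) auto
  have kpos: "k a \<noteq> 0" if "a \<in> A" for a
  proof -
    obtain \<sigma> e s where a: "a = (\<sigma>, e, s)" by (cases a)
    have "\<sigma> (L - 1) < L" using that a L permutes_in_image[of \<sigma> "{0..<L}"] by (auto simp: A_def)
    hence "0 < perm_exponent mu \<sigma> L" using mu(2) by (auto simp: perm_exponent_def)
    thus ?thesis using that a by (auto simp: A_def k_def signs_def)
  qed
  have sumA: "(\<Sum>(\<sigma>, e, s)\<in>A. G \<sigma> e s) = (\<Sum>\<sigma> | \<sigma> permutes {0..<L}. \<Sum>e\<in>signs. G \<sigma> e 1 + G \<sigma> e (- 1))"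
    for G :: "_ \<Rightarrow> _ \<Rightarrow> _ \<Rightarrow> real"
    by (simp add: A_def sum.cartesian_product[symmetric] sum_signs)
  have D: "D_integral L x w F = monomial_sum A c k w" if "w \<in> {x L / x 1<..}" for w
  proof -
    have w: "x L / x 1 < w" using that by simp
    have D: "D_integral L x w F = (\<Sum>\<sigma> | \<sigma> permutes {0..<L}. \<Sum>e\<in>signs.
     D_weight L mu x \<sigma> e * (w powi (e * perm_exponent mu \<sigma> L) + w powi (- (e * perm_exponent mu \<sigma> L))))"
      by (rule D_integral_eq; fact)
    have "monomial_sum A c k w = (\<Sum>(\<sigma>, e, s)\<in>A. D_weight L mu x \<sigma> e * w powi (s * (e * perm_exponent mu \<sigma> L)))"
      unfolding monomial_sum_def c_def k_def
      by (rule sum.cong[OF refl]) (simp only: split_paired_all split_conv)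
    also have "\<dots> = D_integral L x w F"
      unfolding sumA D by (simp only: mult_1 mult_minus1 distrib_left)
    finally show ?thesis ..
  qed
  have "laurent_extension {x L / x 1<..} (\<lambda>w. D_integral L x w F) w = monomial_sum A c k w" for w
    by (rule laurent_extension_monomial_sum[OF finA _ D]) auto
  hence "(LBINT w=1..z. laurent_extension {x L / x 1<..} (\<lambda>w. D_integral L x w F) w / w) =
      (LBINT w=ereal 1..z. monomial_sum A c k w / w)" by (simp add: one_ereal_def)
  also have "\<dots> = (\<Sum>a\<in>A. c a * (z powi k a - 1 powi k a) / real_of_int (k a))"
    by (rule interval_integral_monomial_sum) (use finA z kpos in auto)
  also have "\<dots> = (\<Sum>(\<sigma>, e, s)\<in>A. D_weight L mu x \<sigma> e * (z powi (s * (e * perm_exponent mu \<sigma> L)) - 1) /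
      of_int (s * (e * perm_exponent mu \<sigma> L)))"
    unfolding c_def k_def
    by (rule sum.cong[OF refl]) (simp only: split_paired_all split_conv power_int_1_left)
  also have "\<dots> = (\<Sum>\<sigma> | \<sigma> permutes {0..<L}. \<Sum>e\<in>signs. D_weight L mu x \<sigma> e *
       (z powi (e * perm_exponent mu \<sigma> L) - z powi (- (e * perm_exponent mu \<sigma> L))) /
       of_int (e * perm_exponent mu \<sigma> L))"
    unfolding sumA
  proof (intro sum.cong refl)
    fix \<sigma> e
    \<comment> \<open>The contributions of the lower bound 1 to the two terms are opposite and
      cancel.\<close>
    have "W * (a - 1) / of_int (1 * n) + W * (b - 1) / of_int (- 1 * n) = W * (a - b) / of_int n"
      for W a b :: real and n :: int by (simp add: diff_divide_distrib[symmetric] right_diff_distrib)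
    thus "D_weight L mu x \<sigma> e * (z powi (1 * (e * perm_exponent mu \<sigma> L)) - 1) / of_int (1 * (e * perm_exponent mu \<sigma> L)) +
        D_weight L mu x \<sigma> e * (z powi (- 1 * (e * perm_exponent mu \<sigma> L)) - 1) / of_int (- 1 * (e * perm_exponent mu \<sigma> L)) =
        D_weight L mu x \<sigma> e * (z powi (e * perm_exponent mu \<sigma> L) - z powi (- (e * perm_exponent mu \<sigma> L))) /
          of_int (e * perm_exponent mu \<sigma> L)"
      by (simp only: mult_1 mult_minus1)
  qed
  finally show ?thesis .
qed

section \<open>Divided differences\<close>

text \<open>Repeated synthetic division: the value of \<open>newton_quot v p n\<close> at
  \<open>a\<close> is the divided difference of \<open>p\<close> at \<open>v 0\<close>, ...,
  \<open>v (n - 1)\<close>, \<open>a\<close>, which makes sense also for coinciding nodes.\<close>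

primrec newton_quot :: "(nat \<Rightarrow> real) \<Rightarrow> real poly \<Rightarrow> nat \<Rightarrow> real poly" where
  "newton_quot v p 0 = p"
| "newton_quot v p (Suc n) = synthetic_div (newton_quot v p n) (v n)"

lemma newton_expansion:
  "poly p a = (\<Sum>r<n. (\<Prod>s<r. a - v s) * poly (newton_quot v p r) (v r))
     + (\<Prod>s<n. a - v s) * poly (newton_quot v p n) a"
proof (induction n)
  case (Suc n)
  have "poly (newton_quot v p n) a =
      poly ([:- v n, 1:] * synthetic_div (newton_quot v p n) (v n) + [:poly (newton_quot v p n) (v n):]) a"
    by (simp only: synthetic_div_correct')
  hence "poly (newton_quot v p n) a = (a - v n) * poly (newton_quot v p (Suc n)) a + poly (newton_quot v p n) (v n)"
    by (simp add: algebra_simps)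
  hence "(\<Prod>s<n. a - v s) * poly (newton_quot v p n) a =
      (\<Prod>s<n. a - v s) * ((a - v n) * poly (newton_quot v p (Suc n)) a + poly (newton_quot v p n) (v n))"
    by simp
  thus ?case using Suc by (simp add: algebra_simps)
qed simp

lemma degree_newton_quot: "degree (newton_quot v p n) = degree p - n"
  by (induction n) (auto simp: degree_synthetic_div)

lemma newton_quot_eq_0: "degree p < n \<Longrightarrow> newton_quot v p n = 0"
  by (induction n) (auto simp: less_Suc_eq synthetic_div_eq_0_iff degree_newton_quot)

text \<open>The explicit polynomial dependence on \<open>c\<close> is what makes divided differences
  continuous in their nodes.\<close>

lemma coeff_synthetic_div:
  fixes p :: "real poly"
  shows
  "coeff (synthetic_div p c) n = (\<Sum>i\<in>{n<..degree p}. coeff p i * c ^ (i - Suc n))"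
proof (induction p arbitrary: n)
  case (pCons a p)
  show ?case
  proof (cases "p = 0")
    case False
    have im: "Suc ` {k..degree p} = {k<..Suc (degree p)}" for k
      by (simp add: image_Suc_atLeastAtMost atLeastSucAtMost_greaterThanAtMost)
    have "(\<Sum>i\<in>{n<..Suc (degree p)}. coeff (pCons a p) i * c ^ (i - Suc n)) =
        (\<Sum>i\<in>{n..degree p}. coeff p i * c ^ (i - n))"
      unfolding im[of n, symmetric] by (subst sum.reindex) auto
    also have "\<dots> = coeff (pCons (poly p c) (synthetic_div p c)) n"
    proof (cases n)
      case 0
      thus ?thesis by (simp add: poly_altdef atLeast0AtMost)
    next
      case (Suc k)
      have "{Suc k..degree p} = {k<..degree p}" by auto
      thus ?thesis using Suc pCons.IH[of k] by simp
    qed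
    finally show ?thesis using False by simp
  qed (auto simp: coeff_eq_0)
qed simp

text \<open>The degree of \<open>newton_quot\<close> does not depend on the nodes, so the sum for
  each coefficient has a fixed range and the limit passes through it, one node at a time.\<close>

lemma tendsto_coeff_newton_quot:
  assumes "\<And>s. s < n \<Longrightarrow> ((\<lambda>y. w y s) \<longlongrightarrow> v s) F"
  shows "((\<lambda>y. coeff (newton_quot (w y) p n) k) \<longlongrightarrow> coeff (newton_quot v p n) k) F"
  using assms
proof (induction n arbitrary: k)
  case (Suc n)
  show ?case
    unfolding newton_quot.simps coeff_synthetic_div degree_newton_quot
    by (intro tendsto_intros Suc) (use Suc.prems in auto)
qed auto

lemma tendsto_poly_newton_quot:
  assumes "\<And>s. s < n \<Longrightarrow> ((\<lambda>y. w y s) \<longlongrightarrow> v s) F" "(a \<longlongrightarrow> b) F"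
  shows "((\<lambda>y. poly (newton_quot (w y) p n) (a y)) \<longlongrightarrow> poly (newton_quot v p n) b) F"
  unfolding poly_altdef degree_newton_quot
  by (intro tendsto_intros tendsto_coeff_newton_quot assms)

lemma lead_coeff_synthetic_div:
  fixes p :: "real poly"
  assumes "degree p > 0"
  shows "coeff (synthetic_div p c) (degree p - 1) = lead_coeff p"
proof -
  have "{degree p - 1<..degree p} = {degree p}" using assms by auto
  thus ?thesis using assms by (simp add: coeff_synthetic_div)
qed

text \<open>Each division by a linear factor lowers the degree by one and keeps the leading
  coefficient.\<close>

lemma newton_quot_degree: "newton_quot v p (degree p) = [:lead_coeff p:]"
proof -
  have "coeff (newton_quot v p n) (degree p - n) = lead_coeff p" if "n \<le> degree p" for n
    using that
  proof (induction n)
    case (Suc n)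
    thus ?case using lead_coeff_synthetic_div[of "newton_quot v p n" "v n"]
      by (simp add: degree_newton_quot)
  qed simp
  from this[of "degree p"] have "coeff (newton_quot v p (degree p)) 0 = lead_coeff p" by simp
  moreover have "degree (newton_quot v p (degree p)) = 0" by (simp add: degree_newton_quot)
  ultimately show ?thesis by (metis degree_0_id)
qed

text \<open>The nodes are taken in descending order, \<open>v (n - 1), ..., v r\<close> in row \<open>r\<close>, so that a matrix whose
  polynomials are monic of degrees \<open>n - 1, ..., 0\<close> becomes lower unitriangular and the distinguished
  first variable of \<open>(z, 1, ..., 1)\<close> enters row 0 only.\<close>

definition divided_diff_mat :: "nat \<Rightarrow> (nat \<Rightarrow> real) \<Rightarrow> (nat \<Rightarrow> real poly) \<Rightarrow> real mat" where
  "divided_diff_mat n v p = Matrix.mat n n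
     (\<lambda>(r, j). poly (newton_quot (\<lambda>s. v (n - Suc s)) (p j) (n - Suc r)) (v r))"

definition newton_mat :: "nat \<Rightarrow> (nat \<Rightarrow> real) \<Rightarrow> real mat" where
  "newton_mat n v = Matrix.mat n n (\<lambda>(i, r). \<Prod>s<n - Suc r. v i - v (n - Suc s))"

text \<open>Row \<open>i\<close> is the Newton expansion at \<open>v i\<close>, whose remainder
  vanishes because \<open>v i\<close> is itself a node. The sum is reversed to match the descending
  order of the nodes.\<close>

lemma poly_mat_eq_newton:
  "Matrix.mat n n (\<lambda>(i, j). poly (p j) (v i)) = newton_mat n v * divided_diff_mat n v p"
proof (rule eq_matI)
  fix i j assume "i < dim_row (newton_mat n v * divided_diff_mat n v p)"
    "j < dim_col (newton_mat n v * divided_diff_mat n v p)"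
  hence ij: "i < n" "j < n" by (auto simp: newton_mat_def divided_diff_mat_def)
  define w where "w = (\<lambda>s. v (n - Suc s))"
  have "poly (p j) (v i) = (\<Sum>r<n. (\<Prod>s<r. v i - w s) * poly (newton_quot w (p j) r) (w r))
     + (\<Prod>s<n. v i - w s) * poly (newton_quot w (p j) n) (v i)"
    by (rule newton_expansion)
  \<comment> \<open>The factor with \<open>s = n - Suc i\<close> is
    \<open>v i - v i\<close>.\<close>
  also have "(\<Prod>s<n. v i - w s) = 0"
    using ij by (intro prod_zero) (auto simp: w_def intro!: bexI[of _ "n - Suc i"])
  also have "(\<Sum>r<n. (\<Prod>s<r. v i - w s) * poly (newton_quot w (p j) r) (w r)) =
      (\<Sum>r<n. (\<Prod>s<n - Suc r. v i - w s) * poly (newton_quot w (p j) (n - Suc r)) (w (n - Suc r)))"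
    by (rule sum.nat_diff_reindex[symmetric])
  also have "\<dots> = (\<Sum>r<n. (\<Prod>s<n - Suc r. v i - w s) * poly (newton_quot w (p j) (n - Suc r)) (v r))"
    by (intro sum.cong) (auto simp: w_def Suc_diff_Suc)
  finally show "Matrix.mat n n (\<lambda>(i, j). poly (p j) (v i)) $$ (i, j) =
      (newton_mat n v * divided_diff_mat n v p) $$ (i, j)"
    using ij by (simp add: newton_mat_def divided_diff_mat_def scalar_prod_def w_def atLeast0LessThan)
qed (auto simp: newton_mat_def divided_diff_mat_def)

lemma det_poly_mat:
  "Determinant.det (Matrix.mat n n (\<lambda>(i, j). poly (p j) (v i))) =
     Determinant.det (newton_mat n v) * Determinant.det (divided_diff_mat n v p)"
  unfolding poly_mat_eq_newton
  by (rule det_mult) (auto simp: newton_mat_def divided_diff_mat_def)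

text \<open>Every entry of row \<open>i\<close> below the diagonal contains the factor
  \<open>v i - v i\<close>; on the diagonal only differences of distinct nodes occur.\<close>

lemma det_newton_mat_nonzero:
  fixes v :: "nat \<Rightarrow> real"
  assumes "inj_on v {..<n}"
  shows "Determinant.det (newton_mat n v) \<noteq> 0"
proof -
  have "upper_triangular (newton_mat n v)"
  proof (rule upper_triangularI)
    fix i j assume "j < i" "i < dim_row (newton_mat n v)"
    hence ij: "j < i" "i < n" by (auto simp: newton_mat_def)
    have "(\<Prod>s<n - Suc j. v i - v (n - Suc s)) = 0"
      using ij by (intro prod_zero) (auto intro!: bexI[of _ "n - Suc i"])
    thus "newton_mat n v $$ (i, j) = 0" using ij by (simp add: newton_mat_def)
  qed
  hence "Determinant.det (newton_mat n v) = prod_list (diag_mat (newton_mat n v))"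
    by (rule det_upper_triangular[of _ n]) (simp add: newton_mat_def)
  also have "\<dots> \<noteq> 0"
  proof -
    have "(\<Prod>s<n - Suc i. v i - v (n - Suc s)) \<noteq> 0" if "i < n" for i
    proof (subst prod_zero_iff, simp, rule notI)
      assume "\<exists>a\<in>{..<n - Suc i}. v i - v (n - Suc a) = 0"
      then obtain a where a: "a < n - Suc i" "v i = v (n - Suc a)" by auto
      hence "i = n - Suc a" using assms that by (auto simp: inj_on_def)
      thus False using a by auto
    qed
    thus ?thesis by (auto simp: prod_list_zero_iff diag_mat_def newton_mat_def)
  qed
  finally show ?thesis .
qed

text \<open>Row \<open>r\<close> takes divided differences of order \<open>n - Suc r\<close>. Beyond
  the degree of the polynomial these vanish, and at the degree they equal the leading
  coefficient.\<close>

lemma det_divided_diff_mat_monic: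
  assumes "\<And>j. j < n \<Longrightarrow> degree (p j) = n - Suc j" "\<And>j. j < n \<Longrightarrow> lead_coeff (p j) = 1"
  shows "Determinant.det (divided_diff_mat n v p) = 1"
proof -
  have "Determinant.det (divided_diff_mat n v p) = prod_list (diag_mat (divided_diff_mat n v p))"
  proof (rule det_lower_triangular)
    fix i j :: nat assume "i < j" "j < n"
    thus "divided_diff_mat n v p $$ (i, j) = 0"
      using assms(1)[of j] by (simp add: divided_diff_mat_def newton_quot_eq_0)
  qed (simp add: divided_diff_mat_def)
  also have "\<dots> = (\<Prod>i<n. 1)"
    unfolding prod_list_diag_prod
  proof (rule prod.cong)
    show "{0..<dim_row (divided_diff_mat n v p)} = {..<n}" by (auto simp: divided_diff_mat_def)
    fix i assume "i \<in> {..<n}"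
    thus "divided_diff_mat n v p $$ (i, i) = 1"
      using newton_quot_degree[of "\<lambda>s. v (n - Suc s)" "p i"] assms[of i]
      by (simp add: divided_diff_mat_def)
  qed
  finally show ?thesis by simp
qed

lemma det_poly_mat_monic_nonzero:
  fixes v :: "nat \<Rightarrow> real"
  assumes "\<And>j. j < n \<Longrightarrow> degree (p j) = n - Suc j" "\<And>j. j < n \<Longrightarrow> lead_coeff (p j) = 1"
    and "inj_on v {..<n}"
  shows "Determinant.det (Matrix.mat n n (\<lambda>(i, j). poly (p j) (v i))) \<noteq> 0"
  using det_newton_mat_nonzero[OF assms(3)] det_divided_diff_mat_monic[OF assms(1,2)]
  by (simp add: det_poly_mat)

text \<open>Synthetic division at 0 removes the constant coefficient. Nodes at 0 will correspond to
  variables equal to 1.\<close>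

lemma newton_quot_0: "newton_quot (\<lambda>_. 0) p n = poly_shift n p"
proof (induction n)
  case (Suc n)
  have "poly_shift (Suc n) p = synthetic_div (poly_shift n p) 0"
  proof (rule poly_eqI)
    fix k
    have eq: "q = pCons (poly q 0) (synthetic_div q 0)" for q :: "real poly"
      using synthetic_div_correct[of q 0] by simp
    have "coeff (synthetic_div q 0) k = coeff q (Suc k)" for q :: "real poly"
      using arg_cong[OF eq[of q], of "\<lambda>p. coeff p (Suc k)"] by simp
    thus "coeff (poly_shift (Suc n) p) k = coeff (synthetic_div (poly_shift n p) 0) k"
      by (simp add: coeff_poly_shift)
  qed
  thus ?case using Suc by simp
qed simp

section \<open>Symplectic characters as determinants of divided differences\<close>

text \<open>With v = y + 1/y - 2 this is (y^m - y^(-m)) / (y - 1/y); for m > 0 it is the Chebyshev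
  polynomial of the second kind U_(m-1) at 1 + v/2.\<close>

fun odd_poly :: "nat \<Rightarrow> real poly" where
  "odd_poly 0 = 0"
| "odd_poly (Suc 0) = 1"
| "odd_poly (Suc (Suc n)) = [:2, 1:] * odd_poly (Suc n) - odd_poly n"

definition cosh_var :: "real \<Rightarrow> real" where "cosh_var y = y + inverse y - 2"

lemma powi_diff_eq_odd_poly:
  "y powi int m - y powi (- int m) = (y - inverse y) * poly (odd_poly m) (cosh_var y)"
proof (cases "y = 0")
  \<comment> \<open>At 0 the convention \<open>inverse 0 = 0\<close> makes both sides
    vanish.\<close>
  case True
  thus ?thesis by (cases m) (auto simp: power_int_minus simp del: of_nat_Suc)
next
  case False
  show ?thesis
  proof (induction m rule: odd_poly.induct)
    case (3 n)
    have "poly (odd_poly (Suc (Suc n))) (cosh_var y) =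
        (y + inverse y) * poly (odd_poly (Suc n)) (cosh_var y) - poly (odd_poly n) (cosh_var y)"
      by (simp add: cosh_var_def algebra_simps)
    hence "(y - inverse y) * poly (odd_poly (Suc (Suc n))) (cosh_var y) =
        (y + inverse y) * (y powi int (Suc n) - y powi (- int (Suc n))) - (y powi int n - y powi (- int n))"
      unfolding 3 by (simp add: algebra_simps)
    also have "\<dots> = y powi int (Suc (Suc n)) - y powi (- int (Suc (Suc n)))"
    proof -
      have "y ^ n \<noteq> 0" using False by simp
      thus ?thesis using False
        unfolding power_int_minus power_int_of_nat power_Suc by (simp add: field_simps)
    qed
    finally show ?case ..
  qed auto
qed

lemma odd_poly_degree: "degree (odd_poly (Suc n)) = n \<and> lead_coeff (odd_poly (Suc n)) = 1"
proof (induction n rule: less_induct)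
  case (less n)
  consider "n = 0" | "n = 1" | k where "n = Suc (Suc k)"
    by (metis One_nat_def not0_implies_Suc)
  thus ?case
  proof cases
    case 3
    have 1: "degree (odd_poly (Suc (Suc k))) = Suc k" "lead_coeff (odd_poly (Suc (Suc k))) = 1"
      "degree (odd_poly (Suc k)) = k"
      using less[of "Suc k"] less[of k] 3 by auto
    hence "odd_poly (Suc (Suc k)) \<noteq> 0" by (metis leading_coeff_0_iff zero_neq_one)
    hence 2: "degree ([:2, 1:] * odd_poly (Suc (Suc k))) = Suc (Suc k)"
      by (subst degree_mult_eq) (use 1 in auto)
    have 3: "lead_coeff ([:2, 1:] * odd_poly (Suc (Suc k))) = 1"
      unfolding lead_coeff_mult using 1 by simp
    define r where "r = [:2, 1:] * odd_poly (Suc (Suc k))"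
    define q where "q = odd_poly (Suc k)"
    have "odd_poly (Suc (Suc (Suc k))) = r + - q" by (simp add: r_def q_def)
    moreover have "degree (r + - q) = Suc (Suc k)"
    proof -
      have "degree r = Suc (Suc k)" unfolding r_def by (rule 2)
      moreover have "degree q = k" using 1 by (simp add: q_def)
      ultimately show ?thesis by (subst degree_add_eq_left) simp_all
    qed
    moreover have "coeff q (Suc (Suc k)) = 0" by (rule coeff_eq_0) (use 1 in \<open>simp add: q_def\<close>)
    moreover have "coeff r (Suc (Suc k)) = 1" using 2 3 unfolding r_def by metis
    ultimately have "degree (odd_poly (Suc (Suc (Suc k)))) = Suc (Suc k) \<and>
        lead_coeff (odd_poly (Suc (Suc (Suc k)))) = 1"
      by (simp only: coeff_add coeff_minus) simp
    thus ?thesis unfolding \<open>n = Suc (Suc k)\<close> .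
  qed auto
qed

section \<open>Central factorials and the coefficients of the odd polynomials\<close>

primrec central_factorial :: "nat \<Rightarrow> real \<Rightarrow> real" where
  "central_factorial 0 x = x"
| "central_factorial (Suc k) x = central_factorial k x * (x\<^sup>2 - (real k + 1)\<^sup>2)"

text \<open>\<open>central_factorial k x\<close> is (x - k)(x - k + 1)...(x + k), so both sides are
  the product of the 2k + 2 consecutive factors from x - k to x + k + 1.\<close>

lemma central_factorial_shift:
  "central_factorial k (x + 1) * (x - real k) = central_factorial k x * (x + real k + 1)"
proof (induction k)
  case (Suc k)
  have "central_factorial (Suc k) (x + 1) * (x - real (Suc k)) =
      (central_factorial k (x + 1) * (x - real k)) * ((x + real k + 2) * (x - real k - 1))"
    by (simp add: power2_eq_square algebra_simps)
  thus ?case unfolding Suc by (simp add: power2_eq_square algebra_simps)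
qed (simp add: algebra_simps)

text \<open>The shift identity exhibits \<open>central_factorial k x\<close> as a common factor of
  all three terms, and the quadratic cofactors add up to a constant.\<close>

lemma central_factorial_second_diff:
  "central_factorial (Suc k) (x + 1) + central_factorial (Suc k) (x - 1) - 2 * central_factorial (Suc k) x
     = real (2 * Suc k) * real (2 * Suc k + 1) * central_factorial k x"
proof -
  have "central_factorial (Suc k) (x + 1) = (central_factorial k (x + 1) * (x - real k)) * (x + real k + 2)"
    by (simp add: power2_eq_square algebra_simps)
  also have "\<dots> = central_factorial k x * ((x + real k + 1) * (x + real k + 2))"
    unfolding central_factorial_shift by simp
  finally have 1: "central_factorial (Suc k) (x + 1) = central_factorial k x * ((x + real k + 1) * (x + real k + 2))" .
  have "central_factorial (Suc k) (x - 1) = (central_factorial k (x - 1) * (x - 1 + real k + 1)) * (x - real k - 2)"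
    by (simp add: power2_eq_square algebra_simps)
  also have "\<dots> = central_factorial k x * ((x - 1 - real k) * (x - real k - 2))"
    using central_factorial_shift[of k "x - 1"] by simp
  finally have 2: "central_factorial (Suc k) (x - 1) = central_factorial k x * ((x - 1 - real k) * (x - real k - 2))" .
  show ?thesis unfolding 1 2 by (simp add: power2_eq_square algebra_simps)
qed

text \<open>By the recursion of \<open>odd_poly\<close>, the second difference in \<open>m\<close>
  of the coefficient of degree k is the coefficient of degree k - 1, and central factorials over (2k
  + 1)! obey the same rule. The coefficients are thus odd polynomials in \<open>m\<close>, suited to
  interpolation in m^2.\<close>

lemma coeff_odd_poly: "coeff (odd_poly m) k = central_factorial k (real m) / fact (2 * k + 1)"
proof (induction m arbitrary: k rule: odd_poly.induct)
  case (1 k)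
  have "central_factorial k 0 = 0" by (induction k) auto
  thus ?case by simp
next
  case (2 k)
  have "central_factorial (Suc k) 1 = 0" for k by (induction k) auto
  thus ?case by (cases k) auto
next
  case (3 n)
  define x where "x = real n + 1"
  have x: "real (Suc (Suc n)) = x + 1" "real (Suc n) = x" "real n = x - 1" by (auto simp: x_def)
  have rec: "coeff (odd_poly (Suc (Suc n))) k = 2 * coeff (odd_poly (Suc n)) k +
      (if k = 0 then 0 else coeff (odd_poly (Suc n)) (k - 1)) - coeff (odd_poly n) k"
    by (cases k) auto
  have IH1: "coeff (odd_poly (Suc n)) i = central_factorial i x / fact (2 * i + 1)" for i
    using 3(1)[of i] unfolding x .
  have IH2: "coeff (odd_poly n) i = central_factorial i (x - 1) / fact (2 * i + 1)" for i
    using 3(2)[of i] unfolding x .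
  show ?case
  proof (cases k)
    case 0
    thus ?thesis unfolding rec IH1 IH2 x by simp
  next
    case (Suc j)
    \<comment> \<open>\<open>c\<close> is (2j + 3)! and \<open>b\<close> is (2j + 2)(2j + 3), so
      that c / b is (2j + 1)!.\<close>
    define c :: real where "c = fact (2 * Suc j + 1)"
    define b :: real where "b = real (2 * Suc j) * real (2 * Suc j + 1)"
    have b: "b \<noteq> 0" and c: "c \<noteq> 0" by (auto simp: b_def c_def simp del: fact_Suc)
    have f: "(fact (2 * j + 1) :: real) = c / b"
    proof -
      have "c = b * fact (2 * j + 1)" by (simp add: b_def c_def algebra_simps)
      thus ?thesis using b by simp
    qed
    have "coeff (odd_poly (Suc (Suc n))) k = 2 * (central_factorial (Suc j) x / c) + central_factorial j x / (c / b)
        - central_factorial (Suc j) (x - 1) / c"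
      unfolding Suc rec[unfolded Suc] by (simp only: nat.distinct if_False diff_Suc_1 IH1[of "Suc j", folded c_def]
        IH1[of j, unfolded f] IH2[of "Suc j", folded c_def])
    also have "\<dots> = (2 * central_factorial (Suc j) x + b * central_factorial j x - central_factorial (Suc j) (x - 1)) / c"
      using b c by (simp add: field_simps del: central_factorial.simps)
    also have "b * central_factorial j x = central_factorial (Suc j) (x + 1) + central_factorial (Suc j) (x - 1) -
        2 * central_factorial (Suc j) x"
      unfolding b_def by (rule central_factorial_second_diff[symmetric])
    finally show ?thesis unfolding Suc x c_def by simp
  qed
qed

lemma det_mult_rows:
  fixes f :: "nat \<Rightarrow> nat \<Rightarrow> real"
  shows "Determinant.det (Matrix.mat n n (\<lambda>(i, j). c i * f i j)) =
     (\<Prod>i<n. c i) * Determinant.det (Matrix.mat n n (\<lambda>(i, j). f i j))"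
proof -
  have "(\<Prod>i = 0..<n. Matrix.mat n n (\<lambda>(i, j). c i * f i j) $$ (i, p i)) =
      (\<Prod>i<n. c i) * (\<Prod>i = 0..<n. Matrix.mat n n (\<lambda>(i, j). f i j) $$ (i, p i))"
    if "p permutes {0..<n}" for p
    using permutes_in_image[OF that] by (simp add: prod.distrib[symmetric] atLeast0LessThan)
  thus ?thesis
    by (simp add: det_def'[of _ n] sum_distrib_left mult.left_commute)
qed

section \<open>The quotient of alternants and its continuity\<close>

lemma alternant_eq_odd_poly:
  "alternant L mu y = (\<Prod>i<L. y (Suc i) - inverse (y (Suc i))) *
     Determinant.det (Matrix.mat L L (\<lambda>(i, j). poly (odd_poly (mu (Suc j))) (cosh_var (y (Suc i)))))"
  unfolding alternant_def powi_diff_eq_odd_poly det_mult_rows ..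

lemma delta_pos: "j < L \<Longrightarrow> delta L (Suc j) = Suc (L - Suc j)"
  by (simp add: delta_def)

text \<open>The symplectic character without a denominator: divided differences keep their meaning
  where nodes coincide, so no limit is taken there.\<close>

definition char_det :: "nat \<Rightarrow> (nat \<Rightarrow> nat) \<Rightarrow> (nat \<Rightarrow> real) \<Rightarrow> real" where
  "char_det L mu y = Determinant.det
     (divided_diff_mat L (\<lambda>i. cosh_var (y (Suc i))) (\<lambda>j. odd_poly (mu (Suc j))))"

text \<open>Only the last factor depends on \<open>mu\<close>, and for \<open>mu = delta L\<close>
  it is 1; hence it is the quotient of the two alternants.\<close>

lemma alternant_factor:
  "alternant L mu y = (\<Prod>i<L. y (Suc i) - inverse (y (Suc i))) *
     Determinant.det (newton_mat L (\<lambda>i. cosh_var (y (Suc i)))) * char_det L mu y"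
  unfolding alternant_eq_odd_poly det_poly_mat char_det_def by (simp add: mult.assoc)

lemma char_det_delta: "char_det L (delta L) y = 1"
  unfolding char_det_def
  by (rule det_divided_diff_mat_monic) (metis delta_pos odd_poly_degree)+

lemma alternant_quotient:
  "alternant L mu y = alternant L (delta L) y * char_det L mu y"
  unfolding alternant_factor[of L mu] alternant_factor[of L "delta L"] char_det_delta by simp

text \<open>In the Leibniz expansion every entry is a divided difference, continuous in its nodes
  even where these coincide; \<open>y i \<noteq> 0\<close> serves the \<open>inverse\<close> in
  \<open>cosh_var\<close>.\<close>

lemma tendsto_char_det:
  assumes "\<And>i. i \<in> {1..L} \<Longrightarrow> ((\<lambda>s. g s i) \<longlongrightarrow> y i) F" "\<And>i. i \<in> {1..L} \<Longrightarrow> y i \<noteq> 0"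
  shows "((\<lambda>s. char_det L mu (g s)) \<longlongrightarrow> char_det L mu y) F"
proof -
  have v: "((\<lambda>s. cosh_var (g s (Suc i))) \<longlongrightarrow> cosh_var (y (Suc i))) F" if "i < L" for i
    unfolding cosh_var_def using that by (intro tendsto_intros assms) auto
  have *: "char_det L mu y = (\<Sum>p | p permutes {0..<L}. signof p *
      (\<Prod>i = 0..<L. poly (newton_quot (\<lambda>s. cosh_var (y (Suc (L - Suc s)))) (odd_poly (mu (Suc (p i)))) (L - Suc i))
         (cosh_var (y (Suc i)))))" for y
    unfolding char_det_def
    by (subst det_def'[of _ L])
      (auto simp: divided_diff_mat_def permutes_in_image intro!: sum.cong prod.cong arg_cong2[of _ _ _ _ "(*)"]
        split: prod.splits dest: permutes_in_image)
  show ?thesis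
    unfolding *
    by (intro tendsto_intros tendsto_poly_newton_quot v) auto
qed

lemma cosh_var_eq_iff:
  assumes "a > 0" "b > 0"
  shows "cosh_var a = cosh_var b \<longleftrightarrow> a = b \<or> a * b = 1"
proof -
  have "cosh_var a - cosh_var b = (a - b) * (a * b - 1) / (a * b)"
    using assms by (simp add: cosh_var_def field_simps)
  thus ?thesis using assms by auto
qed

lemma alternant_delta_nonzero:
  assumes "\<And>i. i \<in> {1..L} \<Longrightarrow> y i > 0" "\<And>i. i \<in> {1..L} \<Longrightarrow> y i \<noteq> 1" "inj_on y {1..L}"
    "\<And>i j. i \<in> {1..L} \<Longrightarrow> j \<in> {1..L} \<Longrightarrow> y i * y j \<noteq> 1"
  shows "alternant L (delta L) y \<noteq> 0"
proof -
  have "(\<Prod>i<L. y (Suc i) - inverse (y (Suc i))) \<noteq> 0"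
  proof (subst prod_zero_iff, simp, rule notI)
    assume "\<exists>i\<in>{..<L}. y (Suc i) - inverse (y (Suc i)) = 0"
    then obtain i where i: "i < L" "y (Suc i) = inverse (y (Suc i))" by auto
    hence "y (Suc i) * y (Suc i) = 1" using assms(1)[of "Suc i"] by (simp add: field_simps)
    thus False using assms(4)[of "Suc i" "Suc i"] i by simp
  qed
  moreover have "inj_on (\<lambda>i. cosh_var (y (Suc i))) {..<L}"
  proof (rule inj_onI)
    fix i j assume ij: "i \<in> {..<L}" "j \<in> {..<L}" "cosh_var (y (Suc i)) = cosh_var (y (Suc j))"
    hence "y (Suc i) = y (Suc j)" using assms(1,4)[of "Suc i"] assms(1,4)[of "Suc j"]
      by (subst (asm) cosh_var_eq_iff) auto
    thus "i = j" using assms(3) ij by (auto dest: inj_onD)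
  qed
  ultimately show ?thesis
    using det_newton_mat_nonzero by (simp add: alternant_factor char_det_delta)
qed

text \<open>\<open>symp_char\<close> is a \<open>Lim\<close> within the set where the denominator is
  nonzero, so \<open>y\<close> has to be a limit point of that set. A curve through \<open>y\<close>
  that stays in the set for all small positive parameters shows this.\<close>

lemma trivial_limit_alternant:
  fixes y :: "nat \<Rightarrow> real"
  assumes L: "L \<ge> 1" and pos: "\<And>i. i \<in> {1..L} \<Longrightarrow> y i > 0"
  shows "at y within {u. alternant L (delta L) u \<noteq> 0} \<noteq> bot"
proof
  \<comment> \<open>The logarithms are \<open>ln (y i) + s * real i\<close>. As the speeds are
    distinct and positive, each equation \<open>g s i = g s j\<close> with
    \<open>i \<noteq> j\<close> and each \<open>g s i * g s j = 1\<close> fixes a single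
    \<open>s\<close>.\<close>
  define g where "g = (\<lambda>s i. y i * exp (s * real i))"
  assume bot: "at y within {u. alternant L (delta L) u \<noteq> 0} = bot"
  have "continuous_on UNIV g"
    unfolding g_def by (intro continuous_on_coordinatewise_then_product continuous_intros)
  hence "(g \<longlongrightarrow> g 0) (at 0)" by (simp add: continuous_on_def)
  hence "(g \<longlongrightarrow> y) (at_right 0)" by (auto simp: g_def intro: tendsto_mono[OF at_le])
  moreover have "eventually (\<lambda>s. g s \<in> {u. alternant L (delta L) u \<noteq> 0} \<and> g s \<noteq> y) (at_right 0)"
  proof -
    \<comment> \<open>For \<open>i = j\<close> the first quotient is a division by 0, hence 0, and
      the condition just says \<open>s \<noteq> 0\<close>.\<close>
    have "eventually (\<lambda>s. \<forall>i\<in>{1..L}. \<forall>j\<in>{1..L}.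
        s \<noteq> (ln (y j) - ln (y i)) / (real i - real j) \<and> s \<noteq> - (ln (y i) + ln (y j)) / (real i + real j)) (at_right 0)"
      by (intro eventually_ball_finite ballI eventually_conj eventually_neq_at_within) auto
    moreover have "eventually (\<lambda>s. s > (0::real)) (at_right 0)" by (simp add: eventually_at_right_less)
    ultimately show ?thesis
    proof eventually_elim
      case (elim s)
      have gp: "g s i > 0" if "i \<in> {1..L}" for i using pos[OF that] by (simp add: g_def)
      have lg: "ln (g s i) = ln (y i) + s * real i" if "i \<in> {1..L}" for i
        using pos[OF that] by (simp add: g_def ln_mult)
      have mult: "g s i * g s j \<noteq> 1" if "i \<in> {1..L}" "j \<in> {1..L}" for i j
      proof
        assume "g s i * g s j = 1"
        hence "ln (g s i * g s j) = 0" by simp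
        hence "ln (y i) + s * real i + (ln (y j) + s * real j) = 0"
          using gp[OF that(1)] gp[OF that(2)] lg that by (simp add: ln_mult)
        hence "s = - (ln (y i) + ln (y j)) / (real i + real j)" using that by (simp add: field_simps)
        thus False using elim that by blast
      qed
      have inj: "inj_on (g s) {1..L}"
      proof (rule inj_onI, rule ccontr)
        fix i j assume ij: "i \<in> {1..L}" "j \<in> {1..L}" "g s i = g s j" "i \<noteq> j"
        hence "ln (y i) + s * real i = ln (y j) + s * real j" using lg by metis
        hence "s = (ln (y j) - ln (y i)) / (real i - real j)" using ij by (simp add: field_simps)
        thus False using elim ij by blast
      qed
      have "alternant L (delta L) (g s) \<noteq> 0"
        by (rule alternant_delta_nonzero) (use gp mult inj in \<open>auto, metis mult_1\<close>)
      moreover have "g s 1 \<noteq> y 1" using pos[of 1] L elim by (simp add: g_def)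
      hence "g s \<noteq> y" by auto
      ultimately show ?case by simp
    qed
  qed
  ultimately have "filterlim g (at y within {u. alternant L (delta L) u \<noteq> 0}) (at_right 0)"
    by (simp add: filterlim_at)
  hence "filterlim g bot (at_right (0::real))" by (simp only: bot)
  hence "eventually (\<lambda>_. False) (at_right (0::real))" unfolding filterlim_iff by (elim allE[of _ "\<lambda>_. False"]) simp
  thus False by simp
qed

text \<open>Both functions agree where the denominator is nonzero and \<open>char_det\<close> is
  continuous, so the limit is its value at \<open>y\<close>.\<close>

lemma symp_char_eq_char_det:
  assumes L: "L \<ge> 1" and pos: "\<And>i. i \<in> {1..L} \<Longrightarrow> y i > 0"
  shows "symp_char L lam y = char_det L (\<lambda>j. lam j + delta L j) y"
  unfolding symp_char_def
proof (rule tendsto_Lim[OF trivial_limit_alternant[OF assms]])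
  let ?S = "{u. alternant L (delta L) u \<noteq> 0}"
  let ?mu = "\<lambda>j. lam j + delta L j"
  have "((\<lambda>u. u i) \<longlongrightarrow> y i) (at y within ?S)" for i
  proof -
    have "continuous_on UNIV (\<lambda>u::nat \<Rightarrow> real. u i)" by simp
    hence "((\<lambda>u. u i) \<longlongrightarrow> y i) (at y)" by (simp add: continuous_on_def)
    thus ?thesis by (rule tendsto_within_subset) simp
  qed
  hence "((\<lambda>u. char_det L ?mu u) \<longlongrightarrow> char_det L ?mu y) (at y within ?S)"
    by (rule tendsto_char_det) (use pos in force)
  moreover have "eventually (\<lambda>u. char_det L ?mu u = alternant L ?mu u / alternant L (delta L) u) (at y within ?S)"
    by (rule eventually_at_topological[THEN iffD2])
      (auto intro!: exI[of _ UNIV] simp: alternant_quotient[of L ?mu])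
  ultimately show "((\<lambda>u. alternant L ?mu u / alternant L (delta L) u) \<longlongrightarrow> char_det L ?mu y) (at y within ?S)"
    by (rule Lim_transform_eventually)
qed

section \<open>Lagrange interpolation and the eigenvalue\<close>

lemma prod_linear_monic:
  fixes u :: "nat \<Rightarrow> real"
  shows "finite A \<Longrightarrow> degree (\<Prod>k\<in>A. [:- u k, 1:]) = card A \<and> lead_coeff (\<Prod>k\<in>A. [:- u k, 1:]) = 1"
proof (induction A rule: finite_induct)
  case (insert a A)
  hence "(\<Prod>k\<in>A. [:- u k, 1:]) \<noteq> 0" by (metis leading_coeff_0_iff zero_neq_one)
  hence "degree ([:- u a, 1:] * (\<Prod>k\<in>A. [:- u k, 1:])) = Suc (card A)"
    using insert by (subst degree_mult_eq) auto
  moreover have "lead_coeff ([:- u a, 1:] * (\<Prod>k\<in>A. [:- u k, 1:])) = 1"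
    using insert by (subst lead_coeff_mult) auto
  ultimately show ?case using insert by (simp only: prod.insert card_insert_disjoint simp_thms)
qed simp

text \<open>The Lagrange interpolant \<open>R\<close> of \<open>q\<close> has degree below
  \<open>n\<close> and agrees with \<open>q\<close> at \<open>n\<close> distinct points, so it
  equals \<open>q\<close>. Its coefficient of degree n - 1 is the sum because every
  \<open>N j\<close> is monic of that degree.\<close>

lemma lagrange_leading_coeff:
  fixes u :: "nat \<Rightarrow> real" and q :: "real poly"
  assumes inj: "inj_on u {..<n}" and deg: "degree q < n"
  shows "(\<Sum>j<n. poly q (u j) / (\<Prod>k\<in>{..<n} - {j}. u j - u k)) = coeff q (n - 1)"
proof -
  define W where "W = (\<lambda>j. \<Prod>k\<in>{..<n} - {j}. u j - u k)"
  define N where "N = (\<lambda>j. \<Prod>k\<in>{..<n} - {j}. [:- u k, 1:])"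
  define R where "R = (\<Sum>j<n. Polynomial.smult (poly q (u j) / W j) (N j))"
  have W: "W j \<noteq> 0" if "j < n" for j
    using inj that unfolding W_def by (subst prod_zero_iff) (auto dest: inj_onD)
  have N: "degree (N j) = n - 1" "coeff (N j) (n - 1) = 1" if "j < n" for j
    using prod_linear_monic[of "{..<n} - {j}" u] that by (auto simp: N_def)
  have polyN: "poly (N j) (u i) = (if i = j then W j else 0)" if "i < n" for i j
    using that by (auto simp: N_def W_def poly_prod intro!: prod_zero)
  have "degree R \<le> n - 1"
    unfolding R_def using N by (intro degree_sum_le) (auto intro: order_trans[OF degree_smult_le])
  hence degR: "degree (q - R) < n" using deg by (intro le_less_trans[OF degree_diff_le[of _ "n - 1"]]) auto
  have "poly R (u i) = poly q (u i)" if "i < n" for i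
  proof -
    have "poly R (u i) = (\<Sum>j<n. if i = j then poly q (u i) else 0)"
      unfolding R_def poly_sum poly_smult polyN[OF that] using W that by (intro sum.cong) auto
    thus ?thesis using that by simp
  qed
  hence sub: "u ` {..<n} \<subseteq> {a. poly (q - R) a = 0}" by auto
  have "q - R = 0"
  proof (rule ccontr)
    assume nz: "q - R \<noteq> 0"
    have "n = card (u ` {..<n})" using card_image[OF inj] by simp
    also have "\<dots> \<le> card {a. poly (q - R) a = 0}" by (rule card_mono[OF poly_roots_finite[OF nz] sub])
    also have "\<dots> \<le> degree (q - R)" by (rule card_poly_roots_bound[OF nz])
    finally show False using degR by simp
  qed
  hence "coeff q (n - 1) = coeff R (n - 1)" by simp
  also have "\<dots> = (\<Sum>j<n. poly q (u j) / W j)"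
    unfolding R_def coeff_sum using N by (intro sum.cong) auto
  finally show ?thesis by (simp add: W_def)
qed

text \<open>Cramer's rule: multiplying M b = c e_0 by the adjugate expresses c times the cofactors
  of the first row as the determinant times b. These cofactors do not involve the first row, so
  Laplace expansion may pair them with \<open>f\<close>.\<close>

lemma det_replace_first_row:
  fixes M :: "nat \<Rightarrow> nat \<Rightarrow> real"
  assumes n: "0 < n" and Mb: "\<And>r. r < n \<Longrightarrow> (\<Sum>j<n. M r j * b j) = (if r = 0 then c else 0)"
  shows "c * Determinant.det (Matrix.mat n n (\<lambda>(r, j). if r = 0 then f j else M r j)) =
     Determinant.det (Matrix.mat n n (\<lambda>(r, j). M r j)) * (\<Sum>j<n. f j * b j)"
proof -
  define A where "A = Matrix.mat n n (\<lambda>(r, j). M r j)"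
  define A' where "A' = Matrix.mat n n (\<lambda>(r, j). if r = 0 then f j else M r j)"
  have A: "A \<in> carrier_mat n n" and A': "A' \<in> carrier_mat n n" by (auto simp: A_def A'_def)
  have cof: "c * cofactor A 0 j = Determinant.det A * b j" if j: "j < n" for j
  proof -
    have adj: "(\<Sum>r<n. cofactor A r j * M r k) = (if j = k then Determinant.det A else 0)" if k: "k < n" for k
    proof -
      have "(adj_mat A * A) $$ (j, k) = (Determinant.det A \<cdot>\<^sub>m 1\<^sub>m n) $$ (j, k)" using adj_mat(3)[OF A] by simp
      moreover have "(adj_mat A * A) $$ (j, k) = (\<Sum>r<n. cofactor A r j * M r k)"
        using A j k by (simp add: adj_mat_def scalar_prod_def A_def atLeast0LessThan)
      ultimately show ?thesis using j k by simp
    qed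
    have "c * cofactor A 0 j = (\<Sum>r<n. if r = 0 then cofactor A r j * c else 0)" using n by (simp add: sum.delta)
    also have "\<dots> = (\<Sum>r<n. cofactor A r j * (\<Sum>k<n. M r k * b k))"
      by (intro sum.cong) (auto simp: Mb)
    also have "\<dots> = (\<Sum>k<n. (\<Sum>r<n. cofactor A r j * M r k) * b k)"
      unfolding sum_distrib_left sum_distrib_right by (subst sum.swap) (simp add: mult.assoc)
    also have "\<dots> = (\<Sum>k<n. if j = k then Determinant.det A * b k else 0)"
      by (intro sum.cong) (auto simp: adj)
    also have "\<dots> = Determinant.det A * b j" using j by simp
    finally show ?thesis .
  qed
  have "mat_delete A' 0 j = mat_delete A 0 j" if "j < n" for j
    by (rule eq_matI) (auto simp: mat_delete_def A_def A'_def)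
  hence "cofactor A' 0 j = cofactor A 0 j" if "j < n" for j using that by (simp add: cofactor_def)
  hence "Determinant.det A' = (\<Sum>j<n. f j * cofactor A 0 j)"
    unfolding laplace_expansion_row[OF A' n] by (intro sum.cong) (auto simp: A'_def n)
  hence "c * Determinant.det A' = (\<Sum>j<n. f j * (c * cofactor A 0 j))"
    by (simp add: sum_distrib_left mult_ac)
  also have "\<dots> = Determinant.det A * (\<Sum>j<n. f j * b j)"
    unfolding sum_distrib_left by (intro sum.cong) (auto simp: cof)
  finally show ?thesis by (simp add: A_def A'_def)
qed

text \<open>The vector \<open>b\<close> for \<open>det_replace_first_row\<close>; the factor 1 /
  mu_j offsets the one in front of each polynomial in mu_j^2.\<close>

definition lagrange_weight :: "nat \<Rightarrow> (nat \<Rightarrow> nat) \<Rightarrow> nat \<Rightarrow> real" where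
  "lagrange_weight L mu j = 1 / (real (mu (Suc j)) *
     (\<Prod>k\<in>{..<L} - {j}. (real (mu (Suc j)))\<^sup>2 - (real (mu (Suc k)))\<^sup>2))"

lemma inj_on_squares:
  assumes "inj_on mu {1..L}"
  shows "inj_on (\<lambda>j. (real (mu (Suc j)))\<^sup>2) {..<L}"
proof (rule inj_onI)
  fix i j assume ij: "i \<in> {..<L}" "j \<in> {..<L}" "(real (mu (Suc i)))\<^sup>2 = (real (mu (Suc j)))\<^sup>2"
  hence "mu (Suc i) = mu (Suc j)" by (simp add: power2_eq_iff_nonneg)
  from inj_onD[OF assms this] ij show "i = j" by simp
qed

lemma lagrange_weight_sum:
  assumes "inj_on mu {1..L}" "\<And>j. j \<in> {1..L} \<Longrightarrow> 0 < mu j" "degree q < L"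
  shows "(\<Sum>j<L. real (mu (Suc j)) * poly q ((real (mu (Suc j)))\<^sup>2) * lagrange_weight L mu j) = coeff q (L - 1)"
proof -
  have "real (mu (Suc j)) * poly q ((real (mu (Suc j)))\<^sup>2) * lagrange_weight L mu j =
      poly q ((real (mu (Suc j)))\<^sup>2) / (\<Prod>k\<in>{..<L} - {j}. (real (mu (Suc j)))\<^sup>2 - (real (mu (Suc k)))\<^sup>2)"
    if "j < L" for j
    using assms(2)[of "Suc j"] that by (simp add: lagrange_weight_def)
  thus ?thesis using lagrange_leading_coeff[OF inj_on_squares[OF assms(1)] assms(3)] by simp
qed

text \<open>Transposition turns the mu_j into row factors; what remains is a Vandermonde-like matrix
  of monic polynomials at the distinct nodes mu_j^2. The row scales \<open>d\<close> cover both
  \<open>alternant1\<close> and the coefficients of \<open>odd_poly\<close>.\<close>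

lemma det_odd_powers_nonzero:
  assumes "inj_on mu {1..L}" "\<And>j. j \<in> {1..L} \<Longrightarrow> 0 < mu j"
    and q: "\<And>r. r < L \<Longrightarrow> degree (q r) = L - Suc r" "\<And>r. r < L \<Longrightarrow> lead_coeff (q r) = 1"
    and d: "\<And>r. r < L \<Longrightarrow> d r \<noteq> 0"
  shows "Determinant.det (Matrix.mat L L (\<lambda>(r, j). d r * (real (mu (Suc j)) * poly (q r) ((real (mu (Suc j)))\<^sup>2)))) \<noteq> 0"
proof -
  let ?u = "\<lambda>j. (real (mu (Suc j)))\<^sup>2"
  have "Determinant.det (Matrix.mat L L (\<lambda>(r, j). real (mu (Suc j)) * poly (q r) (?u j))) =
      Determinant.det (transpose_mat (Matrix.mat L L (\<lambda>(r, j). real (mu (Suc j)) * poly (q r) (?u j))))"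
    by (rule det_transpose[symmetric]) auto
  also have "transpose_mat (Matrix.mat L L (\<lambda>(r, j). real (mu (Suc j)) * poly (q r) (?u j))) =
      Matrix.mat L L (\<lambda>(j, r). real (mu (Suc j)) * poly (q r) (?u j))"
    by (rule eq_matI) auto
  also have "Determinant.det \<dots> \<noteq> 0"
    unfolding det_mult_rows using det_poly_mat_monic_nonzero[OF q inj_on_squares[OF assms(1)]] assms(2)
    by (simp add: prod_zero_iff)
  finally show ?thesis unfolding det_mult_rows using d by (simp add: prod_zero_iff)
qed

lemma alternant1_eq:
  "alternant1 L mu = Determinant.det (Matrix.mat L L (\<lambda>(r, j).
     1 * (real (mu (Suc j)) * poly (monom 1 (L - Suc r)) ((real (mu (Suc j)))\<^sup>2))))"
  unfolding alternant1_def by (simp add: poly_monom power_mult)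

text \<open>Row r of \<open>alternant1\<close> is mu_j times the monomial of degree L - 1 - r in
  mu_j^2, so its product with the Lagrange weights is 1 for r = 0 and 0 otherwise.
  \<open>alternant2\<close> differs only in the first row.\<close>

lemma phi_eq_lagrange:
  assumes L: "1 \<le> L" and mu: "inj_on mu {1..L}" "\<And>j. j \<in> {1..L} \<Longrightarrow> 0 < mu j"
  shows "phi L mu z = (\<Sum>j<L. (z powi int (mu (Suc j)) - z powi (- int (mu (Suc j)))) * lagrange_weight L mu j)"
proof -
  have a1: "alternant1 L mu \<noteq> 0"
    unfolding alternant1_eq
    by (rule det_odd_powers_nonzero[OF mu]) (auto simp: degree_monom_eq)
  have "1 * alternant2 L mu z = alternant1 L mu *
      (\<Sum>j<L. (z powi int (mu (Suc j)) - z powi (- int (mu (Suc j)))) * lagrange_weight L mu j)"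
    unfolding alternant1_def alternant2_def
  proof (rule det_replace_first_row)
    fix r assume r: "r < L"
    have "(\<Sum>j<L. real (mu (Suc j)) * poly (monom 1 (L - Suc r)) ((real (mu (Suc j)))\<^sup>2) * lagrange_weight L mu j)
        = coeff (monom 1 (L - Suc r)) (L - 1)"
      by (rule lagrange_weight_sum[OF mu]) (use r in \<open>auto simp: degree_monom_eq\<close>)
    moreover have "L - Suc r = L - 1 \<longleftrightarrow> r = 0" using r by auto
    ultimately show "(\<Sum>j<L. real (mu (Suc j)) ^ (2 * (L - Suc r) + 1) * lagrange_weight L mu j) = (if r = 0 then 1 else 0)"
      by (simp add: poly_monom power_mult)
  qed (use L in simp)
  thus ?thesis using a1 by (simp add: phi_def)
qed

section \<open>Values at (1, ..., 1) and (z, 1, ..., 1)\<close>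

definition central_poly :: "nat \<Rightarrow> real poly" where
  "central_poly k = (\<Prod>l<k. [:- ((real l + 1)\<^sup>2), 1:])"

lemma central_factorial_eq_poly: "central_factorial k x = x * poly (central_poly k) (x\<^sup>2)"
  by (induction k) (simp_all add: central_poly_def algebra_simps)

lemma central_poly_monic: "degree (central_poly k) = k" "lead_coeff (central_poly k) = 1"
  using prod_linear_monic[of "{..<k}" "\<lambda>l. (real l + 1)\<^sup>2"] by (auto simp: central_poly_def)

lemma coeff_central_poly: "coeff (central_poly k) k = 1"
  using central_poly_monic(2)[of k] by (simp only: central_poly_monic(1))

lemma coeff_odd_poly_central:
  "coeff (odd_poly m) k = 1 / fact (2 * k + 1) * (real m * poly (central_poly k) ((real m)\<^sup>2))"
  by (simp add: coeff_odd_poly central_factorial_eq_poly)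

lemma newton_quot_cong: "(\<And>s. s < n \<Longrightarrow> v s = w s) \<Longrightarrow> newton_quot v p n = newton_quot w p n"
  by (induction n) auto

lemma char_det_ones:
  "char_det L mu (\<lambda>_. 1) = Determinant.det (Matrix.mat L L (\<lambda>(r, j). coeff (odd_poly (mu (Suc j))) (L - Suc r)))"
  unfolding char_det_def divided_diff_mat_def
  by (simp add: cosh_var_def newton_quot_0 poly_0_coeff_0 coeff_poly_shift)

lemma char_det_ones_nonzero:
  assumes mu: "inj_on mu {1..L}" "\<And>j. j \<in> {1..L} \<Longrightarrow> 0 < mu j"
  shows "char_det L mu (\<lambda>_. 1) \<noteq> 0"
  unfolding char_det_ones coeff_odd_poly_central
  by (rule det_odd_powers_nonzero[OF mu]) (auto simp: central_poly_monic(1) coeff_central_poly simp del: fact_Suc)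

lemma poly_eq_shift_sum:
  "poly p a = (\<Sum>s<n. coeff p s * a ^ s) + a ^ n * poly (poly_shift n p) (a :: real)"
  using newton_expansion[where p = p and a = a and n = n and v = "\<lambda>_. 0"]
  by (simp add: newton_quot_0 poly_0_coeff_0 coeff_poly_shift mult.commute)

text \<open>At (z, 1, ..., 1) all nodes but the first vanish, so below row 0 the entries are
  coefficients of \<open>odd_poly\<close> and only row 0 depends on \<open>z\<close>. The Lagrange
  weights annihilate the coefficients of degree below L - 1, and replacing the first row leads to
  the interpolation sum for phi_mu(z).\<close>

lemma char_det_first_variable:
  assumes L: "1 \<le> L" and mu: "inj_on mu {1..L}" "\<And>j. j \<in> {1..L} \<Longrightarrow> 0 < mu j"
  shows "(z - inverse z) * cosh_var z ^ (L - 1) / fact (2 * L - 1) * char_det L mu (\<lambda>i. if i = 1 then z else 1) =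
    char_det L mu (\<lambda>_. 1) * phi L mu z"
proof -
  let ?b = "lagrange_weight L mu"
  let ?p = "\<lambda>j. odd_poly (mu (Suc j))"
  \<comment> \<open>\<open>c\<close> is the weighted sum of the coefficients of degree L - 1, with
    value 1 / (2L - 1)!; \<open>g\<close> is row 0, the quotient after L - 1 divisions at 0.\<close>
  define c :: real where "c = 1 / fact (2 * (L - 1) + 1)"
  define g where "g = (\<lambda>j. poly (poly_shift (L - 1) (?p j)) (cosh_var z))"
  have coeff_b: "(\<Sum>j<L. coeff (?p j) k * ?b j) = (if k = L - 1 then c else 0)" if "k < L" for k
  proof -
    have "(\<Sum>j<L. coeff (?p j) k * ?b j) = 1 / fact (2 * k + 1) *
        (\<Sum>j<L. real (mu (Suc j)) * poly (central_poly k) ((real (mu (Suc j)))\<^sup>2) * ?b j)"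
      unfolding coeff_odd_poly_central sum_distrib_left by (simp add: mult.assoc)
    also have "(\<Sum>j<L. real (mu (Suc j)) * poly (central_poly k) ((real (mu (Suc j)))\<^sup>2) * ?b j) = coeff (central_poly k) (L - 1)"
      by (rule lagrange_weight_sum[OF mu]) (use that in \<open>simp_all add: central_poly_monic(1)\<close>)
    also have "\<dots> = (if k = L - 1 then 1 else 0)"
    proof (cases "k = L - 1")
      case False
      thus ?thesis using that central_poly_monic(1)[of k] by (simp add: coeff_eq_0)
    qed (use coeff_central_poly[of k] in simp)
    finally show ?thesis by (simp add: c_def)
  qed
  have "char_det L mu (\<lambda>i. if i = 1 then z else 1) =
      Determinant.det (Matrix.mat L L (\<lambda>(r, j). if r = 0 then g j else coeff (?p j) (L - Suc r)))"
    unfolding char_det_def divided_diff_mat_def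
  proof (rule arg_cong[of _ _ Determinant.det], rule eq_matI)
    fix r j assume "r < dim_row (Matrix.mat L L (\<lambda>(r, j). if r = 0 then g j else coeff (?p j) (L - Suc r)))"
      "j < dim_col (Matrix.mat L L (\<lambda>(r, j). if r = 0 then g j else coeff (?p j) (L - Suc r)))"
    hence rj: "r < L" "j < L" by auto
    have "newton_quot (\<lambda>s. cosh_var (if Suc (L - Suc s) = 1 then z else 1)) (?p j) (L - Suc r) =
        newton_quot (\<lambda>_. 0) (?p j) (L - Suc r)"
      by (rule newton_quot_cong) (auto simp: cosh_var_def)
    thus "Matrix.mat L L (\<lambda>(r, j). poly (newton_quot (\<lambda>s. cosh_var (if Suc (L - Suc s) = 1 then z else 1))
        (?p j) (L - Suc r)) (cosh_var (if Suc r = 1 then z else 1))) $$ (r, j) =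
      Matrix.mat L L (\<lambda>(r, j). if r = 0 then g j else coeff (?p j) (L - Suc r)) $$ (r, j)"
      using rj by (simp add: newton_quot_0 poly_0_coeff_0 coeff_poly_shift g_def) (simp add: cosh_var_def poly_0_coeff_0 coeff_poly_shift)
  qed auto
  moreover have "c * Determinant.det (Matrix.mat L L (\<lambda>(r, j). if r = 0 then g j else coeff (?p j) (L - Suc r))) =
      Determinant.det (Matrix.mat L L (\<lambda>(r, j). coeff (?p j) (L - Suc r))) * (\<Sum>j<L. g j * ?b j)"
    by (rule det_replace_first_row) (use L coeff_b in auto)
  ultimately have 1: "c * char_det L mu (\<lambda>i. if i = 1 then z else 1) = char_det L mu (\<lambda>_. 1) * (\<Sum>j<L. g j * ?b j)"
    by (simp add: char_det_ones)
  \<comment> \<open>The power of \<open>cosh_var z\<close> turns \<open>g j\<close> into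
    \<open>odd_poly\<close> without its terms of degree below L - 1, and the weights annihilate
    those terms.\<close>
  have "cosh_var z ^ (L - 1) * (\<Sum>j<L. g j * ?b j) =
      (\<Sum>j<L. (poly (?p j) (cosh_var z) - (\<Sum>s<L - 1. coeff (?p j) s * cosh_var z ^ s)) * ?b j)"
    unfolding sum_distrib_left
    by (intro sum.cong refl) (subst poly_eq_shift_sum[of _ _ "L - 1"], simp add: g_def)
  also have "\<dots> = (\<Sum>j<L. poly (?p j) (cosh_var z) * ?b j) -
      (\<Sum>s<L - 1. cosh_var z ^ s * (\<Sum>j<L. coeff (?p j) s * ?b j))"
    unfolding sum_distrib_left left_diff_distrib sum_subtractf sum_distrib_right
    by (subst sum.swap) (simp add: mult_ac)
  also have "(\<Sum>s<L - 1. cosh_var z ^ s * (\<Sum>j<L. coeff (?p j) s * ?b j)) = 0"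
    by (intro sum.neutral ballI) (auto simp: coeff_b)
  finally have 2: "cosh_var z ^ (L - 1) * (\<Sum>j<L. g j * ?b j) = (\<Sum>j<L. poly (?p j) (cosh_var z) * ?b j)" by simp
  have phi: "phi L mu z = (\<Sum>j<L. (z powi int (mu (Suc j)) - z powi (- int (mu (Suc j)))) * ?b j)"
    by (rule phi_eq_lagrange[OF L mu])
  have "(z - inverse z) * (\<Sum>j<L. poly (?p j) (cosh_var z) * ?b j) = phi L mu z"
    unfolding phi powi_diff_eq_odd_poly sum_distrib_left by (simp only: mult.assoc)
  hence 3: "(z - inverse z) * (cosh_var z ^ (L - 1) * (\<Sum>j<L. g j * ?b j)) = phi L mu z" by (simp only: 2)
  have "2 * (L - 1) + 1 = 2 * L - 1" using L by simp
  hence "(z - inverse z) * cosh_var z ^ (L - 1) / fact (2 * L - 1) * char_det L mu (\<lambda>i. if i = 1 then z else 1) =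
      (z - inverse z) * cosh_var z ^ (L - 1) * (c * char_det L mu (\<lambda>i. if i = 1 then z else 1))"
    by (simp add: c_def)
  also have "\<dots> = char_det L mu (\<lambda>_. 1) * ((z - inverse z) * (cosh_var z ^ (L - 1) * (\<Sum>j<L. g j * ?b j)))"
    unfolding 1 by (simp only: mult_ac)
  finally show ?thesis unfolding 3 .
qed

lemma inj_on_delta: "inj_on (delta L) {1..L}"
  by (auto simp: inj_on_def delta_def)

text \<open>The factor \<open>K\<close> from \<open>char_det_first_variable\<close> is the same for
  all \<open>mu\<close> and equals phi_delta(z), because \<open>char_det\<close> is 1 for delta. It
  is nonzero since \<open>z\<close> is positive and different from 1.\<close>

lemma q_eigenvalue_eq:
  assumes L: "1 \<le> L" and mu: "inj_on (\<lambda>j. lam j + delta L j) {1..L}" and z: "0 < z" "z \<noteq> 1"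
  shows "phi L (delta L) z \<noteq> 0"
    "q_eigenvalue L lam z = phi L (\<lambda>j. lam j + delta L j) z / phi L (delta L) z"
proof -
  let ?mu = "\<lambda>j. lam j + delta L j"
  define K where "K = (z - inverse z) * cosh_var z ^ (L - 1) / fact (2 * L - 1)"
  have dpos: "0 < delta L j" if "j \<in> {1..L}" for j using that by (auto simp: delta_def)
  have mpos: "0 < lam j + delta L j" if "j \<in> {1..L}" for j using dpos[OF that] by simp
  have "cosh_var z \<noteq> 0" using cosh_var_eq_iff[of z 1] z by (auto simp: cosh_var_def)
  moreover have "z - inverse z \<noteq> 0"
  proof
    assume "z - inverse z = 0"
    hence "z * z = 1" using z by (simp add: field_simps)
    thus False using z by (simp add: square_eq_1_iff)
  qed
  ultimately have K: "K \<noteq> 0" by (simp add: K_def)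
  have phi_delta: "phi L (delta L) z = K"
    using char_det_first_variable[OF L inj_on_delta dpos, of z] by (simp add: char_det_delta K_def)
  thus "phi L (delta L) z \<noteq> 0" using K by simp
  have "K * char_det L ?mu (\<lambda>i. if i = 1 then z else 1) = char_det L ?mu (\<lambda>_. 1) * phi L ?mu z"
    using char_det_first_variable[OF L mu mpos, of z] by (simp add: K_def)
  moreover have q: "q_eigenvalue L lam z = char_det L ?mu (\<lambda>i. if i = 1 then z else 1) / char_det L ?mu (\<lambda>_. 1)"
    unfolding q_eigenvalue_def using z by (simp add: symp_char_eq_char_det[OF L])
  moreover have nz: "char_det L ?mu (\<lambda>_. 1) \<noteq> 0" by (rule char_det_ones_nonzero[OF mu mpos])
  ultimately have "char_det L ?mu (\<lambda>_. 1) * (K * q_eigenvalue L lam z) = char_det L ?mu (\<lambda>_. 1) * phi L ?mu z"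
    by simp
  hence "K * q_eigenvalue L lam z = phi L ?mu z" using nz by simp
  thus "q_eigenvalue L lam z = phi L ?mu z / phi L (delta L) z"
    unfolding phi_delta using K by (simp add: nonzero_eq_divide_eq mult.commute)
qed

section \<open>The determinant of scaled row differences\<close>

text \<open>Expansion along column \<open>j\<close>, whose cofactors do not involve that column. It
  will merge the determinants for the two signs \<open>e\<close>.\<close>

lemma det_column_linear:
  fixes h :: "nat \<Rightarrow> nat \<Rightarrow> real"
  assumes j: "j < n" and A: "finite A"
  shows "(\<Sum>a\<in>A. d a * Determinant.det (Matrix.mat n n (\<lambda>(i, k). if k = j then g a i else h i k))) =
    Determinant.det (Matrix.mat n n (\<lambda>(i, k). if k = j then (\<Sum>a\<in>A. d a * g a i) else h i k))"
proof -
  define M where "M = (\<lambda>c. Matrix.mat n n (\<lambda>(i, k). if k = j then c i else h i k))"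
  have M: "M c \<in> carrier_mat n n" for c by (simp add: M_def)
  have del: "mat_delete (M c) i j = mat_delete (M (\<lambda>_. 0)) i j" for c i
    by (rule eq_matI) (auto simp: mat_delete_def M_def)
  have cof: "cofactor (M c) i j = cofactor (M (\<lambda>_. 0)) i j" for c i
    unfolding cofactor_def del[of c] ..
  have "Determinant.det (M c) = (\<Sum>i<n. c i * cofactor (M (\<lambda>_. 0)) i j)" for c
    unfolding laplace_expansion_column[OF M j] cof[of c]
    by (rule sum.cong[OF refl]) (simp add: M_def j)
  note det = this
  have "(\<Sum>a\<in>A. d a * Determinant.det (M (g a))) = Determinant.det (M (\<lambda>i. \<Sum>a\<in>A. d a * g a i))"
    unfolding det sum_distrib_left sum_distrib_right by (subst sum.swap) (simp add: mult.assoc)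
  thus ?thesis by (simp add: M_def)
qed

text \<open>Column \<open>j\<close> of \<open>h\<close> is \<open>c\<close>, so the scaled row differences have a zero in that column
  except in the last row.\<close>

lemma det_scaled_row_differences:
  fixes h :: "nat \<Rightarrow> nat \<Rightarrow> real" and c :: "nat \<Rightarrow> real"
  assumes n: "0 < n" and j: "j < n" and hj: "\<And>i. i < n \<Longrightarrow> h i j = c i" and c: "\<And>i. i < n \<Longrightarrow> c i \<noteq> 0"
  shows "(\<Sum>\<sigma> | \<sigma> permutes {0..<n} \<and> \<sigma> (n - 1) = j. signof \<sigma> * c (n - 1) *
      (\<Prod>i<n - 1. c i / c (Suc i) * h (Suc i) (\<sigma> i) - h i (\<sigma> i))) =
    (- 1) ^ (n - 1) * Determinant.det (Matrix.mat n n (\<lambda>(i, k). h i k))"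
proof -
  define b where "b = (\<lambda>i k. if i = n - 1 then h i k else c i / c (Suc i) * h (Suc i) k - h i k)"
  define B where "B = Matrix.mat n n (\<lambda>(i, k). b i k)"
  define H where "H = Matrix.mat n n (\<lambda>(i, k). h i k)"
  \<comment> \<open>Left multiplication by \<open>T\<close> forms the scaled row differences and
    keeps the last row; \<open>T\<close> is upper triangular with diagonal -1, ..., -1, 1.\<close>
  define T where "T = Matrix.mat n n (\<lambda>(i, k). if i = n - 1 then (if k = n - 1 then 1 else 0)
     else if k = i then - 1 else if k = Suc i then c i / c (Suc i) else 0)"
  have carr: "B \<in> carrier_mat n n" "H \<in> carrier_mat n n" "T \<in> carrier_mat n n"
    by (auto simp: B_def H_def T_def)
  have "B = T * H"
  proof (rule eq_matI)
    fix i k assume "i < dim_row (T * H)" "k < dim_col (T * H)"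
    hence ik: "i < n" "k < n" by (auto simp: T_def H_def)
    have "(T * H) $$ (i, k) = (\<Sum>l<n. T $$ (i, l) * h l k)"
      using ik by (simp add: T_def H_def scalar_prod_def atLeast0LessThan)
    also have "\<dots> = b i k"
    proof (cases "i = n - 1")
      case True
      have "(\<Sum>l<n. T $$ (i, l) * h l k) = (\<Sum>l<n. if l = i then h l k else 0)"
        using ik True by (intro sum.cong) (auto simp: T_def)
      thus ?thesis using ik True by (simp add: b_def)
    next
      case False
      have "(\<Sum>l<n. T $$ (i, l) * h l k) =
          (\<Sum>l<n. (if l = i then - h l k else 0) + (if l = Suc i then c i / c l * h l k else 0))"
        using ik False by (intro sum.cong) (auto simp: T_def)
      also have "\<dots> = - h i k + c i / c (Suc i) * h (Suc i) k"
        using ik False by (simp add: sum.distrib)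
      finally show ?thesis using False by (simp add: b_def)
    qed
    finally show "B $$ (i, k) = (T * H) $$ (i, k)" using ik by (simp add: B_def)
  qed (auto simp: B_def T_def H_def)
  hence "Determinant.det B = Determinant.det T * Determinant.det H"
    using det_mult[OF carr(3,2)] by simp
  also have "Determinant.det T = (- 1) ^ (n - 1)"
  proof -
    have "upper_triangular T" by (rule upper_triangularI) (auto simp: T_def)
    hence "Determinant.det T = (\<Prod>i = 0..<n. T $$ (i, i))"
      using det_upper_triangular[OF _ carr(3)] carr(3) by (simp add: prod_list_diag_prod)
    also have "{0..<n} = insert (n - 1) {0..<n - 1}" using n by auto
    also have "(\<Prod>i\<in>insert (n - 1) {0..<n - 1}. T $$ (i, i)) = (\<Prod>i = 0..<n - 1. - 1)"
      using n by (simp add: T_def)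
    finally show ?thesis by simp
  qed
  finally have detB: "Determinant.det B = (- 1) ^ (n - 1) * Determinant.det H" .
  have b_eq: "(\<Prod>i = 0..<n. B $$ (i, \<sigma> i)) = (if \<sigma> (n - 1) = j then c (n - 1) *
      (\<Prod>i<n - 1. c i / c (Suc i) * h (Suc i) (\<sigma> i) - h i (\<sigma> i)) else 0)"
    if \<sigma>: "\<sigma> permutes {0..<n}" for \<sigma>
  proof -
    have s: "\<sigma> i < n" if "i < n" for i using permutes_in_image[OF \<sigma>, of i] that by simp
    have "(\<Prod>i = 0..<n. B $$ (i, \<sigma> i)) = (\<Prod>i\<in>insert (n - 1) {..<n - 1}. b i (\<sigma> i))"
      using n s by (intro prod.cong) (auto simp: B_def)
    also have "\<dots> = h (n - 1) (\<sigma> (n - 1)) * (\<Prod>i<n - 1. b i (\<sigma> i))" by (simp add: b_def)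
    also have "(\<Prod>i<n - 1. b i (\<sigma> i)) = (\<Prod>i<n - 1. c i / c (Suc i) * h (Suc i) (\<sigma> i) - h i (\<sigma> i))"
      by (intro prod.cong) (auto simp: b_def)
    finally have eq: "(\<Prod>i = 0..<n. B $$ (i, \<sigma> i)) = h (n - 1) (\<sigma> (n - 1)) *
        (\<Prod>i<n - 1. c i / c (Suc i) * h (Suc i) (\<sigma> i) - h i (\<sigma> i))" .
    show ?thesis
    proof (cases "\<sigma> (n - 1) = j")
      case True
      thus ?thesis using eq hj[of "n - 1"] n by simp
    next
      case False
      \<comment> \<open>Now \<open>\<sigma>\<close> meets column \<open>j\<close> in a row above the
        last one, where the scaled difference is 0.\<close>
      obtain i where i: "\<sigma> i = j" using permutes_surj[OF \<sigma>] by (metis surjD)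
      hence "i < n" using permutes_in_image[OF \<sigma>, of i] j by simp
      moreover have "i \<noteq> n - 1" using False i by auto
      ultimately have i': "i < n - 1" by linarith
      hence "c i / c (Suc i) * h (Suc i) (\<sigma> i) - h i (\<sigma> i) = 0"
        using hj[of i] hj[of "Suc i"] c[of "Suc i"] i by simp
      hence "(\<Prod>i<n - 1. c i / c (Suc i) * h (Suc i) (\<sigma> i) - h i (\<sigma> i)) = 0"
        using i' by (intro prod_zero) auto
      thus ?thesis using eq False by simp
    qed
  qed
  have "Determinant.det B = (\<Sum>\<sigma> | \<sigma> permutes {0..<n}. if \<sigma> (n - 1) = j then signof \<sigma> * c (n - 1) *
      (\<Prod>i<n - 1. c i / c (Suc i) * h (Suc i) (\<sigma> i) - h i (\<sigma> i)) else 0)"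
    unfolding det_def'[OF carr(1)] by (intro sum.cong) (simp_all add: b_eq mult.assoc)
  also have "\<dots> = (\<Sum>\<sigma> | \<sigma> permutes {0..<n} \<and> \<sigma> (n - 1) = j. signof \<sigma> * c (n - 1) *
      (\<Prod>i<n - 1. c i / c (Suc i) * h (Suc i) (\<sigma> i) - h i (\<sigma> i)))"
    by (simp add: sum.inter_filter[symmetric] finite_permutations)
  finally show ?thesis using detB by (simp add: H_def)
qed

section \<open>The eigenvalue equation\<close>

text \<open>This turns a product over the first L - 1 positions into one over all indices except the
  last value of \<open>\<sigma>\<close>, and so into a quantity that depends on that value
  only.\<close>

lemma permutes_last_bij_betw:
  fixes L :: nat
  assumes "\<sigma> permutes {0..<L}" "1 \<le> L"
  shows "bij_betw \<sigma> {..<L - 1} ({..<L} - {\<sigma> (L - 1)})"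
proof -
  have "{..<L - 1} = {..<L} - {L - 1}" using assms(2) by auto
  moreover have "\<sigma> ` ({..<L} - {L - 1}) = \<sigma> ` {..<L} - \<sigma> ` {L - 1}"
    by (rule image_set_diff[OF permutes_inj[OF assms(1)]])
  moreover have "\<sigma> ` {..<L} = {..<L}"
    using permutes_image[OF assms(1)] unfolding lessThan_atLeast0 .
  ultimately have "\<sigma> ` {..<L - 1} = {..<L} - {\<sigma> (L - 1)}" by simp
  thus ?thesis by (intro bij_betw_imageI inj_on_subset[OF permutes_inj[OF assms(1)]]) auto
qed

text \<open>Permutations are grouped by \<open>j = \<sigma> (L - 1)\<close>, which fixes n up to
  sign. In each group the numerators sum to a determinant with column \<open>j\<close> replaced by
  the powers x_i^n; the signed sum over \<open>e\<close> restores \<open>alternant L mu x\<close>,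
  and the remaining factors are the terms in \<open>phi_eq_lagrange\<close>.\<close>

lemma sum_D_weight:
  fixes x :: "nat \<Rightarrow> real"
  assumes L: "1 \<le> L" and x: "\<And>l. l \<in> {1..L} \<Longrightarrow> 0 < x l"
    and mu: "inj_on mu {1..L}" "\<And>j. j \<in> {1..L} \<Longrightarrow> 0 < mu j"
  shows "(\<Sum>\<sigma> | \<sigma> permutes {0..<L}. \<Sum>e\<in>signs. D_weight L mu x \<sigma> e *
       (z powi (e * perm_exponent mu \<sigma> L) - z powi (- (e * perm_exponent mu \<sigma> L))) /
       of_int (e * perm_exponent mu \<sigma> L)) = phi L mu z * alternant L mu x"
proof -
  define f where "f = (\<lambda>k (y::real). y powi int (mu (Suc k)) - y powi (- int (mu (Suc k))))"
  define c where "c = (\<lambda>j e i. x (Suc i) powi (e * int (mu (Suc j))))"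
  define h where "h = (\<lambda>j e i k. if k = j then c j e i else f k (x (Suc i)))"
  define core where "core = (\<lambda>j e \<sigma>. signof \<sigma> * c j e (L - 1) *
      (\<Prod>i<L - 1. c j e i / c j e (Suc i) * h j e (Suc i) (\<sigma> i) - h j e i (\<sigma> i)))"
  \<comment> \<open>The differences are oriented opposite to \<open>lagrange_weight\<close>; the
    resulting sign (-1)^(L-1) cancels that of \<open>det_scaled_row_differences\<close>.\<close>
  define den where "den = (\<lambda>j. \<Prod>k\<in>{..<L} - {j}. (real (mu (Suc k)))\<^sup>2 - (real (mu (Suc j)))\<^sup>2)"
  define \<beta> where "\<beta> = (\<lambda>j. f j z / (real (mu (Suc j)) * den j))"
  have Suc_im: "{1..<L} = Suc ` {..<L - 1}"
    using L by (cases L) (simp_all add: image_Suc_lessThan atLeastLessThanSuc_atLeastAtMost)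
  have term_eq: "D_weight L mu x \<sigma> e *
       (z powi (e * perm_exponent mu \<sigma> L) - z powi (- (e * perm_exponent mu \<sigma> L))) /
       of_int (e * perm_exponent mu \<sigma> L) = \<beta> (\<sigma> (L - 1)) * (of_int e * core (\<sigma> (L - 1)) e \<sigma>)"
    if \<sigma>: "\<sigma> permutes {0..<L}" and e: "e \<in> signs" for \<sigma> e
  proof -
    define j where "j = \<sigma> (L - 1)"
    define N where "N = e * int (mu (Suc j))"
    have e': "e = 1 \<or> e = - 1" using e by (simp add: signs_def)
    have exL: "perm_exponent mu \<sigma> L = int (mu (Suc j))" by (simp add: perm_exponent_def j_def)
    have N2: "N\<^sup>2 = (int (mu (Suc j)))\<^sup>2" using e' by (auto simp: N_def)
    have dens: "(\<Prod>l=1..<L. of_int ((perm_exponent mu \<sigma> l)\<^sup>2 - N\<^sup>2)) = den j"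
    proof -
      have "(\<Prod>l=1..<L. of_int ((perm_exponent mu \<sigma> l)\<^sup>2 - N\<^sup>2)) =
          (\<Prod>i<L - 1. (real (mu (Suc (\<sigma> i))))\<^sup>2 - (real (mu (Suc j)))\<^sup>2)"
        unfolding Suc_im N2 by (subst prod.reindex) (auto simp: perm_exponent_def)
      also have "\<dots> = den j"
        unfolding den_def j_def
        by (rule prod.reindex_bij_betw[OF permutes_last_bij_betw[OF \<sigma> L],
            of "\<lambda>k. (real (mu (Suc k)))\<^sup>2 - (real (mu (Suc (\<sigma> (L - 1)))))\<^sup>2"])
      finally show ?thesis .
    qed
    have nums: "(\<Prod>l=1..<L. x l powi N * x (Suc l) powi (- N) *
          (x (Suc l) powi perm_exponent mu \<sigma> l - x (Suc l) powi (- perm_exponent mu \<sigma> l)) -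
          (x l powi perm_exponent mu \<sigma> l - x l powi (- perm_exponent mu \<sigma> l))) =
        (\<Prod>i<L - 1. c j e i / c j e (Suc i) * h j e (Suc i) (\<sigma> i) - h j e i (\<sigma> i))"
    proof -
      have "\<sigma> i \<noteq> j" if "i < L - 1" for i
      proof
        assume "\<sigma> i = j"
        hence "i = L - 1" unfolding j_def by (rule injD[OF permutes_inj[OF \<sigma>]])
        thus False using that by simp
      qed
      hence h: "h j e i' (\<sigma> i) = f (\<sigma> i) (x (Suc i'))" if "i < L - 1" for i i' using that by (simp add: h_def)
      show ?thesis unfolding Suc_im
      proof (subst prod.reindex, simp, rule prod.cong[OF refl])
        fix i assume "i \<in> {..<L - 1}"
        hence i: "i < L - 1" by simp
        have c': "c j e i / c j e (Suc i) = x (Suc i) powi N * x (Suc (Suc i)) powi (- N)"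
          by (simp add: c_def N_def power_int_minus divide_inverse)
        show "((\<lambda>l. x l powi N * x (Suc l) powi (- N) *
          (x (Suc l) powi perm_exponent mu \<sigma> l - x (Suc l) powi (- perm_exponent mu \<sigma> l)) -
          (x l powi perm_exponent mu \<sigma> l - x l powi (- perm_exponent mu \<sigma> l))) \<circ> Suc) i =
          c j e i / c j e (Suc i) * h j e (Suc i) (\<sigma> i) - h j e i (\<sigma> i)"
          unfolding c' h[OF i] by (simp add: f_def perm_exponent_def)
      qed
    qed
    have D: "D_weight L mu x \<sigma> e = of_int e * core j e \<sigma> / den j"
    proof -
      have "D_weight L mu x \<sigma> e = signof \<sigma> * of_int e * x L powi N *
          ((\<Prod>i<L - 1. c j e i / c j e (Suc i) * h j e (Suc i) (\<sigma> i) - h j e i (\<sigma> i)) / den j)"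
        unfolding D_weight_def Let_def exL N_def[symmetric] prod_dividef nums dens ..
      moreover have "x L powi N = c j e (L - 1)" using L by (simp add: c_def N_def)
      ultimately show ?thesis by (simp add: core_def mult_ac)
    qed
    \<comment> \<open>The quotient is even in \<open>N\<close>, hence the same for both signs
      \<open>e\<close>.\<close>
    have zN: "(z powi N - z powi (- N)) / of_int N = f j z / real (mu (Suc j))"
      using e' by (auto simp: N_def f_def minus_divide_left)
    have "D_weight L mu x \<sigma> e * (z powi N - z powi (- N)) / of_int N =
        (of_int e * core j e \<sigma> / den j) * (f j z / real (mu (Suc j)))"
      unfolding D zN[symmetric] by simp
    thus ?thesis unfolding exL N_def[symmetric] j_def[symmetric] by (simp add: \<beta>_def mult_ac)
  qed
  have alt: "(\<Sum>e\<in>signs. of_int e * Determinant.det (Matrix.mat L L (\<lambda>(i, k). h j e i k))) = alternant L mu x"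
    if "j < L" for j
  proof -
    have "finite signs" by (simp add: signs_def)
    from det_column_linear[OF that this, of of_int "c j" "\<lambda>i k. f k (x (Suc i))"]
    have "(\<Sum>e\<in>signs. of_int e * Determinant.det (Matrix.mat L L (\<lambda>(i, k). h j e i k))) =
        Determinant.det (Matrix.mat L L (\<lambda>(i, k). if k = j then (\<Sum>e\<in>signs. of_int e * c j e i) else f k (x (Suc i))))"
      unfolding h_def .
    also have "(\<lambda>(i, k). if k = j then (\<Sum>e\<in>signs. of_int e * c j e i) else f k (x (Suc i))) =
        (\<lambda>(i, k). f k (x (Suc i)))"
      by (auto simp: fun_eq_iff sum_signs c_def f_def)
    finally show ?thesis by (simp add: alternant_def f_def)
  qed
  have det: "(\<Sum>\<sigma> | \<sigma> permutes {0..<L} \<and> \<sigma> (L - 1) = j. core j e \<sigma>) =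
      (- 1) ^ (L - 1) * Determinant.det (Matrix.mat L L (\<lambda>(i, k). h j e i k))" if "j < L" for j e
    unfolding core_def
  proof (rule det_scaled_row_differences)
    show "c j e i \<noteq> 0" if "i < L" for i using x[of "Suc i"] that by (simp add: c_def)
  qed (use L that in \<open>simp_all add: h_def\<close>)
  have sign_den: "(- 1) ^ (L - 1) * \<beta> j = f j z * lagrange_weight L mu j" if "j < L" for j
  proof -
    let ?d = "\<Prod>k\<in>{..<L} - {j}. (real (mu (Suc j)))\<^sup>2 - (real (mu (Suc k)))\<^sup>2"
    have "den j = (\<Prod>k\<in>{..<L} - {j}. - 1 * ((real (mu (Suc j)))\<^sup>2 - (real (mu (Suc k)))\<^sup>2))"
      unfolding den_def by (rule prod.cong) simp_all
    also have "\<dots> = (- 1) ^ (L - 1) * ?d" unfolding prod.distrib using that by simp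
    finally have "den j = (- 1) ^ (L - 1) * ?d" .
    moreover have "(- 1) ^ (L - 1) = (1::real) \<or> (- 1) ^ (L - 1) = (- 1::real)"
      using power_minus1_odd neg_one_even_power by (cases "even (L - 1)") auto
    ultimately show ?thesis unfolding \<beta>_def lagrange_weight_def by (elim disjE) simp_all
  qed
  have "(\<Sum>\<sigma> | \<sigma> permutes {0..<L}. \<Sum>e\<in>signs. D_weight L mu x \<sigma> e *
       (z powi (e * perm_exponent mu \<sigma> L) - z powi (- (e * perm_exponent mu \<sigma> L))) /
       of_int (e * perm_exponent mu \<sigma> L)) =
     (\<Sum>\<sigma> | \<sigma> permutes {0..<L}. \<beta> (\<sigma> (L - 1)) * (\<Sum>e\<in>signs. of_int e * core (\<sigma> (L - 1)) e \<sigma>))"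
    unfolding sum_distrib_left by (intro sum.cong refl) (simp only: term_eq mem_Collect_eq sum_distrib_left)
  also have "\<dots> = (\<Sum>j<L. \<Sum>\<sigma> | \<sigma> \<in> {\<sigma>. \<sigma> permutes {0..<L}} \<and> \<sigma> (L - 1) = j.
      \<beta> (\<sigma> (L - 1)) * (\<Sum>e\<in>signs. of_int e * core (\<sigma> (L - 1)) e \<sigma>))"
  proof (rule sum.group[symmetric])
    show "(\<lambda>\<sigma>. \<sigma> (L - 1)) ` {\<sigma>. \<sigma> permutes {0..<L}} \<subseteq> {..<L}"
    proof (rule image_subsetI)
      fix \<sigma> assume "\<sigma> \<in> {\<sigma>. \<sigma> permutes {0..<L}}"
      thus "\<sigma> (L - 1) \<in> {..<L}" using permutes_in_image[of \<sigma> "{0..<L}" "L - 1"] L by simp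
    qed
  qed (simp_all add: finite_permutations)
  also have "\<dots> = (\<Sum>j<L. \<beta> j * (\<Sum>e\<in>signs. of_int e *
      (\<Sum>\<sigma> | \<sigma> permutes {0..<L} \<and> \<sigma> (L - 1) = j. core j e \<sigma>)))"
  proof (rule sum.cong[OF refl])
    fix j
    have "(\<Sum>\<sigma> | \<sigma> \<in> {\<sigma>. \<sigma> permutes {0..<L}} \<and> \<sigma> (L - 1) = j.
        \<beta> (\<sigma> (L - 1)) * (\<Sum>e\<in>signs. of_int e * core (\<sigma> (L - 1)) e \<sigma>)) =
      (\<Sum>\<sigma> | \<sigma> permutes {0..<L} \<and> \<sigma> (L - 1) = j. \<beta> j * (\<Sum>e\<in>signs. of_int e * core j e \<sigma>))"
      by (intro sum.cong) auto
    also have "\<dots> = \<beta> j * (\<Sum>e\<in>signs. of_int e *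
      (\<Sum>\<sigma> | \<sigma> permutes {0..<L} \<and> \<sigma> (L - 1) = j. core j e \<sigma>))"
      unfolding sum_distrib_left by (rule sum.swap)
    finally show "(\<Sum>\<sigma> | \<sigma> \<in> {\<sigma>. \<sigma> permutes {0..<L}} \<and> \<sigma> (L - 1) = j.
        \<beta> (\<sigma> (L - 1)) * (\<Sum>e\<in>signs. of_int e * core (\<sigma> (L - 1)) e \<sigma>)) =
      \<beta> j * (\<Sum>e\<in>signs. of_int e * (\<Sum>\<sigma> | \<sigma> permutes {0..<L} \<and> \<sigma> (L - 1) = j. core j e \<sigma>))" .
  qed
  also have "\<dots> = (\<Sum>j<L. f j z * lagrange_weight L mu j * alternant L mu x)"
  proof (rule sum.cong[OF refl])
    fix j assume "j \<in> {..<L}"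
    hence j: "j < L" by simp
    have "\<beta> j * (\<Sum>e\<in>signs. of_int e * (\<Sum>\<sigma> | \<sigma> permutes {0..<L} \<and> \<sigma> (L - 1) = j. core j e \<sigma>)) =
      (- 1) ^ (L - 1) * \<beta> j * (\<Sum>e\<in>signs. of_int e * Determinant.det (Matrix.mat L L (\<lambda>(i, k). h j e i k)))"
      unfolding det[OF j] sum_distrib_left by (simp add: mult_ac)
    thus "\<beta> j * (\<Sum>e\<in>signs. of_int e * (\<Sum>\<sigma> | \<sigma> permutes {0..<L} \<and> \<sigma> (L - 1) = j. core j e \<sigma>)) =
      f j z * lagrange_weight L mu j * alternant L mu x"
      unfolding alt[OF j] sign_den[OF j] .
  qed
  also have "\<dots> = phi L mu z * alternant L mu x"
  proof -
    have "phi L mu z = (\<Sum>j<L. (z powi int (mu (Suc j)) - z powi (- int (mu (Suc j)))) * lagrange_weight L mu j)"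
      by (rule phi_eq_lagrange[OF L mu])
    thus ?thesis by (simp add: f_def sum_distrib_right)
  qed
  finally show ?thesis .
qed

theorem proposition4p6p1:
  fixes L :: nat and lam :: "nat \<Rightarrow> nat" and x :: "nat \<Rightarrow> real" and z :: real
  assumes "L \<ge> 1"
    and "antimono_on {1..L} lam"
    and "\<forall>i\<in>{1..L}. 0 < x i"
    and "mono_on {1..L} x"
    and "alternant L (delta L) x \<noteq> 0"
    and "0 < z" and "z \<noteq> 1"
  shows "Q_operator L z (symp_char L lam) x = q_eigenvalue L lam z * symp_char L lam x"
proof -
  define mu where "mu = (\<lambda>j. lam j + delta L j)"
  have pos: "0 < x l" if "l \<in> {1..L}" for l using assms(3) that by blast
  have mono: "x l \<le> x (Suc l)" if "l \<in> {1..<L}" for l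
    by (rule monotone_onD[OF assms(4)]) (use that in auto)
  have mu_pos: "0 < mu j" if "j \<in> {1..L}" for j using that by (simp add: mu_def delta_def)
  have "mu j < mu i" if "i \<in> {1..L}" "j \<in> {1..L}" "i < j" for i j
  proof -
    have "lam j \<le> lam i" by (rule monotone_onD[OF assms(2)]) (use that in auto)
    thus ?thesis using that by (simp add: mu_def delta_def)
  qed
  hence mu_inj: "inj_on mu {1..L}" by (intro linorder_inj_onI) (force simp: less_imp_neq[symmetric])+
  \<comment> \<open>Positive tuples suffice: interlacing and the ranges of y_L keep every entry of y
    positive.\<close>
  have F: "alternant L (delta L) y * symp_char L lam y = alternant L mu y"
    if "\<And>l. l \<in> {1..L} \<Longrightarrow> 0 < y l" for y
  proof -
    have "symp_char L lam y = char_det L mu y"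
      unfolding mu_def by (rule symp_char_eq_char_det[OF assms(1) that])
    thus ?thesis by (simp add: alternant_quotient[of L mu])
  qed
  have q: "phi L (delta L) z \<noteq> 0" "q_eigenvalue L lam z = phi L mu z / phi L (delta L) z"
    using q_eigenvalue_eq[OF assms(1) _ assms(6,7)] mu_inj unfolding mu_def by blast+
  have "(LBINT w=1..z. laurent_extension {x L / x 1<..}
      (\<lambda>w. D_integral L x w (\<lambda>y. alternant L (delta L) y * symp_char L lam y)) w / w) =
    (\<Sum>\<sigma> | \<sigma> permutes {0..<L}. \<Sum>e\<in>signs. D_weight L mu x \<sigma> e *
       (z powi (e * perm_exponent mu \<sigma> L) - z powi (- (e * perm_exponent mu \<sigma> L))) /
       of_int (e * perm_exponent mu \<sigma> L))"
    by (rule integral_laurent_extension_D_integral; fact)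
  also have "\<dots> = phi L mu z * alternant L mu x"
    by (rule sum_D_weight; fact)
  also have "\<dots> = phi L mu z * (alternant L (delta L) x * symp_char L lam x)"
    using F[of x] pos by simp
  finally show ?thesis unfolding Q_operator_def q(2) using q(1) assms(5) by simp
qed

end
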